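(* There is an algorithm which, given $S\in\mathbb R^{m\times n}$, runs in time polynomial in $m,n$, determines whether $S$ is a 1-product, and in case it is, outputs two matrices $S_1,S_2$ such that $S$ is isomorphic to $S_1\otimes S_2$.
   Context: Two matrices are isomorphic if one is obtained from the other by permuting rows and columns. For $S_1\in\mathbb R^{m_1\times n_1}$, $S_2\in\mathbb R^{m_2\times n_2}$, the 1-product $S_1\otimes S_2\in\mathbb R^{(m_1+m_2)\times n_1n_2}$ is the matrix whose $((a-1)n_2+b)$-th column is the $a$-th column of $S_1$ stacked on top of the $b$-th column of $S_2$. A matrix $S$ is a 1-product if it is isomorphic to $S_1\otimes S_2$ for some non-empty matrices $S_1,S_2$. *)

theory Defs
  imports
    Jordan_Normal_Form.Matrix
    "HOL-Combinatorics.Permutations"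
begin

definition matrix_iso :: "'a mat \<Rightarrow> 'a mat \<Rightarrow> bool" where
  "matrix_iso A B \<longleftrightarrow>
     (\<exists>p q. p permutes {..<dim_row A} \<and> q permutes {..<dim_col A} \<and>
        B = mat (dim_row A) (dim_col A) (\<lambda>(i, j). A $$ (p i, q j)))"

text \<open>Indices start at 0, so the column given by column \<open>a\<close> of the first factor and
  column \<open>b\<close> of the second one has index \<open>a * n2 + b\<close>.\<close>

definition one_prod :: "'a mat \<Rightarrow> 'a mat \<Rightarrow> 'a mat" (infixl "\<otimes>\<^sub>1" 70) where
  "S1 \<otimes>\<^sub>1 S2 =
     mat (dim_row S1 + dim_row S2) (dim_col S1 * dim_col S2)
       (\<lambda>(i, j). if i < dim_row S1 then S1 $$ (i, j div dim_col S2)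
                 else S2 $$ (i - dim_row S1, j mod dim_col S2))"

definition nonempty_mat :: "'a mat \<Rightarrow> bool" where
  "nonempty_mat A \<longleftrightarrow> 0 < dim_row A \<and> 0 < dim_col A"

definition is_one_product :: "'a mat \<Rightarrow> bool" where
  "is_one_product S \<longleftrightarrow>
     (\<exists>S1 S2. nonempty_mat S1 \<and> nonempty_mat S2 \<and> matrix_iso S (S1 \<otimes>\<^sub>1 S2))"

text \<open>
  Algorithms on real matrices are programs for a real RAM, written in a structured while
  language. The memory consists of named arrays of natural numbers and named arrays of exact
  real numbers; array names are fixed in the program text, indices are computed. A scalar
  variable is an array used at index 0 only.

  Every operation, array access and control step costs one time unit. Two restrictions keep this
  unit-cost measure honest. Naturals can only be added, subtracted and compared: after \<open>t\<close> steps
  they have \<open>O(t)\<close> more bits than the inputs and program constants, whereas unit-cost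
  multiplication would allow repeated squaring. Reals admit exact
  field arithmetic and comparison but no rounding and no conversion to naturals, and the only real
  constants are 0 and 1, so that no real parameter can be hidden in the program text.
\<close>

record state =
  nmem :: "string \<Rightarrow> nat \<Rightarrow> nat"
  rmem :: "string \<Rightarrow> nat \<Rightarrow> real"

datatype nexp =
    NConst nat
  | NArr string nexp
  | NAdd nexp nexp
  | NSub nexp nexp

datatype rexp =
    RZero
  | ROne
  | RArr string nexp
  | RAdd rexp rexp
  | RSub rexp rexp
  | RMul rexp rexp
  | RDiv rexp rexp

datatype bexp =
    NEq nexp nexp
  | NLess nexp nexp
  | REq rexp rexp
  | RLess rexp rexp
  | BNot bexp
  | BAnd bexp bexp

datatype com =
    Skip
  | NAssign string nexp nexp    \<comment> \<open>array, index, value\<close>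
  | RAssign string nexp rexp
  | Seq com com
  | Cond bexp com com
  | While bexp com

text \<open>Subtraction of naturals is truncated at 0, and real division by 0 yields 0.\<close>

fun nval :: "nexp \<Rightarrow> state \<Rightarrow> nat" where
  "nval (NConst k) s = k"
| "nval (NArr x e) s = nmem s x (nval e s)"
| "nval (NAdd e f) s = nval e s + nval f s"
| "nval (NSub e f) s = nval e s - nval f s"

fun rval :: "rexp \<Rightarrow> state \<Rightarrow> real" where
  "rval RZero s = 0"
| "rval ROne s = 1"
| "rval (RArr x e) s = rmem s x (nval e s)"
| "rval (RAdd e f) s = rval e s + rval f s"
| "rval (RSub e f) s = rval e s - rval f s"
| "rval (RMul e f) s = rval e s * rval f s"
| "rval (RDiv e f) s = rval e s / rval f s"

fun bval :: "bexp \<Rightarrow> state \<Rightarrow> bool" where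
  "bval (NEq e f) s \<longleftrightarrow> nval e s = nval f s"
| "bval (NLess e f) s \<longleftrightarrow> nval e s < nval f s"
| "bval (REq e f) s \<longleftrightarrow> rval e s = rval f s"
| "bval (RLess e f) s \<longleftrightarrow> rval e s < rval f s"
| "bval (BNot b) s \<longleftrightarrow> \<not> bval b s"
| "bval (BAnd b c) s \<longleftrightarrow> bval b s \<and> bval c s"

fun ncost :: "nexp \<Rightarrow> nat" where
  "ncost (NConst k) = 1"
| "ncost (NArr x e) = ncost e + 1"
| "ncost (NAdd e f) = ncost e + ncost f + 1"
| "ncost (NSub e f) = ncost e + ncost f + 1"

fun rcost :: "rexp \<Rightarrow> nat" where
  "rcost RZero = 1"
| "rcost ROne = 1"
| "rcost (RArr x e) = ncost e + 1"
| "rcost (RAdd e f) = rcost e + rcost f + 1"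
| "rcost (RSub e f) = rcost e + rcost f + 1"
| "rcost (RMul e f) = rcost e + rcost f + 1"
| "rcost (RDiv e f) = rcost e + rcost f + 1"

fun bcost :: "bexp \<Rightarrow> nat" where
  "bcost (NEq e f) = ncost e + ncost f + 1"
| "bcost (NLess e f) = ncost e + ncost f + 1"
| "bcost (REq e f) = rcost e + rcost f + 1"
| "bcost (RLess e f) = rcost e + rcost f + 1"
| "bcost (BNot b) = bcost b + 1"
| "bcost (BAnd b c) = bcost b + bcost c + 1"

definition nupd :: "string \<Rightarrow> nat \<Rightarrow> nat \<Rightarrow> state \<Rightarrow> state" where
  "nupd x i v s = s\<lparr>nmem := (nmem s)(x := (nmem s x)(i := v))\<rparr>"

definition rupd :: "string \<Rightarrow> nat \<Rightarrow> real \<Rightarrow> state \<Rightarrow> state" where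
  "rupd x i v s = s\<lparr>rmem := (rmem s)(x := (rmem s x)(i := v))\<rparr>"

text \<open>\<open>exec c s t s'\<close>: started in state \<open>s\<close>, program \<open>c\<close> halts in state \<open>s'\<close> after exactly \<open>t\<close>
  time units.\<close>

inductive exec :: "com \<Rightarrow> state \<Rightarrow> nat \<Rightarrow> state \<Rightarrow> bool" where
  exec_Skip: "exec Skip s 1 s"
| exec_NAssign:
    "exec (NAssign x e f) s (ncost e + ncost f + 1) (nupd x (nval e s) (nval f s) s)"
| exec_RAssign:
    "exec (RAssign x e f) s (ncost e + rcost f + 1) (rupd x (nval e s) (rval f s) s)"
| exec_Seq:
    "exec c s t s' \<Longrightarrow> exec d s' u s'' \<Longrightarrow> exec (Seq c d) s (t + u) s''"
| exec_CondTrue: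
    "bval b s \<Longrightarrow> exec c s t s' \<Longrightarrow> exec (Cond b c d) s (bcost b + 1 + t) s'"
| exec_CondFalse:
    "\<not> bval b s \<Longrightarrow> exec d s t s' \<Longrightarrow> exec (Cond b c d) s (bcost b + 1 + t) s'"
| exec_WhileFalse:
    "\<not> bval b s \<Longrightarrow> exec (While b c) s (bcost b + 1) s"
| exec_WhileTrue:
    "bval b s \<Longrightarrow> exec c s t s' \<Longrightarrow> exec (While b c) s' u s'' \<Longrightarrow>
     exec (While b c) s (bcost b + 1 + t + u) s''"

inductive_cases exec_SkipE: "exec Skip s t s'"
inductive_cases exec_NAssignE: "exec (NAssign x e f) s t s'"
inductive_cases exec_RAssignE: "exec (RAssign x e f) s t s'"
inductive_cases exec_SeqE: "exec (Seq c d) s t s'"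
inductive_cases exec_CondE: "exec (Cond b c d) s t s'"
inductive_cases exec_WhileE: "exec (While b c) s t s'"

lemma exec_deterministic:
  "exec c s t s' \<Longrightarrow> exec c s u s'' \<Longrightarrow> u = t \<and> s'' = s'"
proof (induction arbitrary: u s'' rule: exec.induct)
  case exec_Skip
  from exec_Skip.prems show ?case by (rule exec_SkipE) simp_all
next
  case exec_NAssign
  from exec_NAssign.prems show ?case by (rule exec_NAssignE) simp_all
next
  case exec_RAssign
  from exec_RAssign.prems show ?case by (rule exec_RAssignE) simp_all
next
  case (exec_Seq c s t s' d t' s0)
  from exec_Seq.prems show ?case
  proof (rule exec_SeqE)
    fix v s1 w
    assume u: "u = v + w" and v: "exec c s v s1" and w: "exec d s1 w s''"
    from exec_Seq.IH(1)[OF v] have 1: "v = t" "s1 = s'" by simp_all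
    from exec_Seq.IH(2)[OF w[unfolded 1]] show ?thesis by (simp add: u 1)
  qed
next
  case (exec_CondTrue b s c t s' d)
  from exec_CondTrue.prems show ?case
  proof (rule exec_CondE)
    fix v
    assume u: "u = Suc (bcost b + v)" and v: "exec c s v s''"
    from exec_CondTrue.IH[OF v] show ?thesis by (simp add: u)
  qed (simp add: exec_CondTrue.hyps)
next
  case (exec_CondFalse b s d t s' c)
  from exec_CondFalse.prems show ?case
  proof (rule exec_CondE)
    fix v
    assume u: "u = Suc (bcost b + v)" and v: "exec d s v s''"
    from exec_CondFalse.IH[OF v] show ?thesis by (simp add: u)
  qed (simp add: exec_CondFalse.hyps)
next
  case (exec_WhileFalse b s c)
  from exec_WhileFalse.prems show ?case
    by (rule exec_WhileE) (simp_all add: exec_WhileFalse.hyps)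
next
  case (exec_WhileTrue b s c t s' t' s0)
  from exec_WhileTrue.prems show ?case
  proof (rule exec_WhileE)
    fix v s1 w
    assume u: "u = Suc (bcost b + v + w)" and v: "exec c s v s1"
      and w: "exec (While b c) s1 w s''"
    from exec_WhileTrue.IH(1)[OF v] have 1: "v = t" "s1 = s'" by simp_all
    from exec_WhileTrue.IH(2)[OF w[unfolded 1]] show ?thesis by (simp add: u 1)
  qed (simp add: exec_WhileTrue.hyps)
qed

text \<open>Matrices are stored row by row; all memory not holding the input is initially 0.\<close>

definition input_state :: "real mat \<Rightarrow> state" where
  "input_state S =
     \<lparr>nmem = (\<lambda>x i. if x = ''m'' \<and> i = 0 then dim_row S
                     else if x = ''n'' \<and> i = 0 then dim_col S else 0),
      rmem = (\<lambda>x i. if x = ''S'' \<and> i < dim_row S * dim_col S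
                     then S $$ (i div dim_col S, i mod dim_col S) else 0)\<rparr>"

text \<open>The verdict, and the matrix held in a real array together with two scalars for the
  numbers of its rows and columns.\<close>

definition output_yes :: "state \<Rightarrow> bool" where
  "output_yes s \<longleftrightarrow> nmem s ''yes'' 0 = 1"

definition output_mat :: "string \<Rightarrow> string \<Rightarrow> string \<Rightarrow> state \<Rightarrow> real mat" where
  "output_mat A r c s =
     mat (nmem s r 0) (nmem s c 0) (\<lambda>(i, j). rmem s A (i * nmem s c 0 + j))"

definition output_S1 :: "state \<Rightarrow> real mat" where
  "output_S1 = output_mat ''S1'' ''m1'' ''n1''"

definition output_S2 :: "state \<Rightarrow> real mat" where
  "output_S2 = output_mat ''S2'' ''m2'' ''n2''"

end

theory Submission
  imports Defs
begin

text \<open>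
  Let \<open>c(z)\<close> be the number of columns equal to the vector \<open>z\<close>. Then \<open>S\<close> is a 1-product with the row
  partition \<open>A, B\<close> iff \<open>c(z)\<close> is a product of a natural number depending on \<open>z|A\<close> and one depending
  on \<open>z|B\<close>; since a rank one matrix of naturals is a product of vectors of naturals (divide by a
  gcd), this holds iff \<open>c(x) c(y) = c(x|A, y|B) c(y|A, x|B)\<close> for all columns \<open>x, y\<close>.

  The algorithm grows a set \<open>A\<close> of rows that lies in the block of row 0 in every factorisation,
  starting from \<open>A = {0}\<close>. If the identity fails for some pair of columns, take such a pair for which
  the set \<open>D\<close> of rows outside \<open>A\<close> in which \<open>x\<close> and \<open>y\<close> differ is of minimal size. For a block \<open>A'\<close>
  of a factorisation that contains \<open>A\<close>, also \<open>x\<close> and the column \<open>(y|A', x|B')\<close> violate the identity, so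
  minimality forces \<open>D \<subseteq> A'\<close>, and \<open>D\<close> is added to \<open>A\<close>. Once no pair is left, either \<open>A\<close> is the set of
  all rows and \<open>S\<close> is not a 1-product, or \<open>A\<close> and its complement give a factorisation.

  To avoid computing a gcd, the widths \<open>n\<^sub>1 n\<^sub>2 = n\<close> of the factors are found by trying all pairs: among the
  columns with the same restriction to \<open>A\<close>, every \<open>n\<^sub>2\<close>-th one is put into the first factor, and
  the second factor is obtained in the same way. The pair is right iff this yields exactly \<open>n\<^sub>1\<close> and
  \<open>n\<^sub>2\<close> columns.
\<close>

section \<open>Reasoning about programs\<close>

fun nw :: "com \<Rightarrow> string set" where
  "nw Skip = {}"
| "nw (NAssign x e f) = {x}"
| "nw (RAssign x e f) = {}"
| "nw (Seq c d) = nw c \<union> nw d"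
| "nw (Cond b c d) = nw c \<union> nw d"
| "nw (While b c) = nw c"

fun rw :: "com \<Rightarrow> string set" where
  "rw Skip = {}"
| "rw (NAssign x e f) = {}"
| "rw (RAssign x e f) = {x}"
| "rw (Seq c d) = rw c \<union> rw d"
| "rw (Cond b c d) = rw c \<union> rw d"
| "rw (While b c) = rw c"

text \<open>Framing works on whole arrays: indices are computed at run time, so the program text
  reveals only the names that may be written.\<close>

definition frame :: "string set \<Rightarrow> string set \<Rightarrow> state \<Rightarrow> state \<Rightarrow> bool" where
  "frame X Y s s' \<longleftrightarrow>
     (\<forall>x. x \<notin> X \<longrightarrow> nmem s' x = nmem s x) \<and> (\<forall>y. y \<notin> Y \<longrightarrow> rmem s' y = rmem s y)"

lemma frame_nmem: "frame X Y s s' \<Longrightarrow> x \<notin> X \<Longrightarrow> nmem s' x = nmem s x"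
  and frame_rmem: "frame X Y s s' \<Longrightarrow> y \<notin> Y \<Longrightarrow> rmem s' y = rmem s y"
  by (simp_all add: frame_def)

lemma upd_simps [simp]:
  "nmem (nupd x i v s) y = (if x = y then (nmem s y)(i := v) else nmem s y)"
  "rmem (nupd x i v s) = rmem s"
  "rmem (rupd x i r s) y = (if x = y then (rmem s y)(i := r) else rmem s y)"
  "nmem (rupd x i r s) = nmem s"
  by (auto simp: nupd_def rupd_def)

lemma exec_frame: "exec c s t s' \<Longrightarrow> frame (nw c) (rw c) s s'"
  by (induction rule: exec.induct) (auto simp: frame_def)

section \<open>Polynomial bounds on running time\<close>

text \<open>An upper bound on the running time if no execution of a loop makes more than \<open>N\<close> iterations.\<close>

fun tb :: "nat \<Rightarrow> com \<Rightarrow> nat" where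
  "tb N Skip = 1"
| "tb N (NAssign x e f) = ncost e + ncost f + 1"
| "tb N (RAssign x e f) = ncost e + rcost f + 1"
| "tb N (Seq c d) = tb N c + tb N d"
| "tb N (Cond b c d) = bcost b + 1 + tb N c + tb N d"
| "tb N (While b c) = (N + 1) * (bcost b + 1 + tb N c)"

text \<open>Each loop raises the exponent by one. For \<open>Seq\<close> and \<open>Cond\<close> the
  exponents are added, which is crude but lets both powers be bounded by monotonicity, the base
  \<open>N + 1\<close> being at least 1.\<close>

lemma tb_polynomial: "\<exists>a k. \<forall>N. tb N c \<le> a * (N + 1) ^ k"
proof (induction c)
  case Skip
  show ?case by (rule exI[of _ 1], rule exI[of _ 0]) simp
next
  case (NAssign x e f)
  show ?case by (rule exI[of _ "ncost e + ncost f + 1"], rule exI[of _ 0]) simp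
next
  case (RAssign x e f)
  show ?case by (rule exI[of _ "ncost e + rcost f + 1"], rule exI[of _ 0]) simp
next
  case (Seq c d)
  then obtain a k b l where c: "\<And>N. tb N c \<le> a * (N + 1) ^ k" and d: "\<And>N. tb N d \<le> b * (N + 1) ^ l"
    by blast
  have "tb N (Seq c d) \<le> (a + b) * (N + 1) ^ (k + l)" for N
  proof -
    have "(N + 1) ^ k \<le> (N + 1) ^ (k + l)" "(N + 1) ^ l \<le> (N + 1) ^ (k + l)"
      by (intro power_increasing; simp)+
    then have "a * (N + 1) ^ k \<le> a * (N + 1) ^ (k + l)" "b * (N + 1) ^ l \<le> b * (N + 1) ^ (k + l)"
      by (intro mult_left_mono; simp)+
    with c[of N] d[of N] show ?thesis by (simp only: tb.simps distrib_right)
  qed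
  then show ?case by blast
next
  case (Cond g c d)
  then obtain a k b l where c: "\<And>N. tb N c \<le> a * (N + 1) ^ k" and d: "\<And>N. tb N d \<le> b * (N + 1) ^ l"
    by blast
  have "tb N (Cond g c d) \<le> (bcost g + 1 + a + b) * (N + 1) ^ (k + l)" for N
  proof -
    have "(N + 1) ^ k \<le> (N + 1) ^ (k + l)" "(N + 1) ^ l \<le> (N + 1) ^ (k + l)"
      by (intro power_increasing; simp)+
    then have "a * (N + 1) ^ k \<le> a * (N + 1) ^ (k + l)" "b * (N + 1) ^ l \<le> b * (N + 1) ^ (k + l)"
      "(bcost g + 1) * 1 \<le> (bcost g + 1) * (N + 1) ^ (k + l)"
      by (intro mult_left_mono; simp)+
    with c[of N] d[of N] show ?thesis by (simp only: tb.simps distrib_right mult_1_right)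
  qed
  then show ?case by blast
next
  case (While g c)
  then obtain a k where c: "\<And>N. tb N c \<le> a * (N + 1) ^ k" by blast
  have "tb N (While g c) \<le> (bcost g + 1 + a) * (N + 1) ^ (Suc k)" for N
  proof -
    have "(bcost g + 1) * 1 \<le> (bcost g + 1) * (N + 1) ^ k" by (intro mult_left_mono; simp)
    with c[of N] have "bcost g + 1 + tb N c \<le> (bcost g + 1 + a) * (N + 1) ^ k"
      by (simp only: distrib_right mult_1_right)
    from mult_left_mono[OF this, of "N + 1"] show ?thesis
      by (simp only: tb.simps power_Suc mult.left_commute)
  qed
  then show ?case by blast
qed

section \<open>Total correctness with a time bound\<close>

text \<open>The time bound is the syntactic \<open>tb N c\<close>, so it composes by itself and
  postconditions can speak about values only.\<close>

definition runs :: "nat \<Rightarrow> com \<Rightarrow> state \<Rightarrow> (state \<Rightarrow> bool) \<Rightarrow> bool" where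
  "runs N c s Q \<longleftrightarrow> (\<exists>t s'. exec c s t s' \<and> t \<le> tb N c \<and> Q s')"

text \<open>The rule of consequence, with the frame of the execution supplied for free.\<close>

lemma runs_mono:
  assumes "runs N c s Q" and "\<And>s'. frame (nw c) (rw c) s s' \<Longrightarrow> Q s' \<Longrightarrow> R s'"
  shows "runs N c s R"
  using assms exec_frame unfolding runs_def by meson

lemma runs_Skip: "Q s \<Longrightarrow> runs N Skip s Q"
  unfolding runs_def using exec_Skip by force

lemma runs_NAssign: "Q (nupd x (nval e s) (nval f s) s) \<Longrightarrow> runs N (NAssign x e f) s Q"
  unfolding runs_def using exec_NAssign by force

lemma runs_RAssign: "Q (rupd x (nval e s) (rval f s) s) \<Longrightarrow> runs N (RAssign x e f) s Q"
  unfolding runs_def using exec_RAssign by force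

lemma runs_Seq:
  assumes "runs N c s P" and "\<And>s'. frame (nw c) (rw c) s s' \<Longrightarrow> P s' \<Longrightarrow> runs N d s' Q"
  shows "runs N (Seq c d) s Q"
proof -
  obtain t s' where c: "exec c s t s'" "t \<le> tb N c" "P s'" using assms(1) by (auto simp: runs_def)
  obtain u s'' where d: "exec d s' u s''" "u \<le> tb N d" "Q s''"
    using assms(2)[OF exec_frame[OF c(1)] c(3)] by (auto simp: runs_def)
  show ?thesis unfolding runs_def using exec_Seq[OF c(1) d(1)] c(2) d(2,3)
    by (intro exI[of _ "t + u"] exI[of _ s'']) simp
qed

text \<open>Backward form for leading assignments: the assignment rule turns the goal into one about
  the rest of the program in an updated state.\<close>

lemma runs_Seq_wp: "runs N c s (\<lambda>s'. runs N d s' Q) \<Longrightarrow> runs N (Seq c d) s Q"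
  by (rule runs_Seq)

lemma runs_Cond:
  assumes "bval b s \<Longrightarrow> runs N c s Q" and "\<not> bval b s \<Longrightarrow> runs N d s Q"
  shows "runs N (Cond b c d) s Q"
proof (cases "bval b s")
  case True
  obtain t s' where c: "exec c s t s'" "t \<le> tb N c" "Q s'"
    using assms(1)[OF True] by (auto simp: runs_def)
  show ?thesis unfolding runs_def using exec_CondTrue[OF True c(1)] c(2,3)
    by (intro exI[of _ "bcost b + 1 + t"] exI[of _ s']) simp
next
  case False
  obtain t s' where d: "exec d s t s'" "t \<le> tb N d" "Q s'"
    using assms(2)[OF False] by (auto simp: runs_def)
  show ?thesis unfolding runs_def using exec_CondFalse[OF False d(1)] d(2,3)
    by (intro exI[of _ "bcost b + 1 + t"] exI[of _ s']) simp
qed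

text \<open>The first argument of \<open>I\<close> is a ghost iteration number. Induction goes
  downwards from \<open>K\<close>, where only the last, failing test is paid for; this is the
  \<open>+ 1\<close> in the bound.\<close>

lemma exec_While_count:
  assumes "j \<le> K" and "I j s"
    and step: "\<And>k s'. k < K \<Longrightarrow> I k s' \<Longrightarrow> bval b s' \<and> (\<exists>t s''. exec c s' t s'' \<and> t \<le> T \<and> I (Suc k) s'')"
    and fin: "\<And>s'. I K s' \<Longrightarrow> \<not> bval b s'"
  shows "\<exists>t s'. exec (While b c) s t s' \<and> t \<le> (K - j + 1) * (bcost b + 1 + T) \<and> I K s'"
  using assms(1,2)
proof (induction j arbitrary: s rule: inc_induct)
  case base
  then show ?case using exec_WhileFalse[OF fin[OF base]]
    by (intro exI[of _ "bcost b + 1"] exI[of _ s]) simp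
next
  case (step j)
  obtain t s' where c: "bval b s" "exec c s t s'" "t \<le> T" "I (Suc j) s'"
    using assms(3)[OF step.hyps(2) step.prems] by blast
  obtain u s'' where w: "exec (While b c) s' u s''" "u \<le> (K - Suc j + 1) * (bcost b + 1 + T)" "I K s''"
    using step.IH[OF c(4)] by blast
  have "bcost b + 1 + t + u \<le> (bcost b + 1 + T) + (K - Suc j + 1) * (bcost b + 1 + T)"
    using c(3) w(2) by linarith
  also have "\<dots> = (K - j + 1) * (bcost b + 1 + T)"
  proof -
    have "K - j = Suc (K - Suc j)" using step.hyps(2) by simp
    then show ?thesis by simp
  qed
  finally show ?case using exec_WhileTrue[OF c(1,2) w(1)] w(3) by blast
qed

section \<open>Counting loops, filters and counters\<close>

abbreviation V :: "string \<Rightarrow> nexp" where "V x \<equiv> NArr x (NConst 0)"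

abbreviation assign :: "string \<Rightarrow> nexp \<Rightarrow> com" (infix "::=" 62) where
  "x ::= e \<equiv> NAssign x (NConst 0) e"

definition For :: "string \<Rightarrow> string \<Rightarrow> com \<Rightarrow> com" where
  "For x h c = Seq (x ::= NConst 0) (While (NLess (V x) (V h)) (Seq c (x ::= NAdd (V x) (NConst 1))))"

lemma nw_For [simp]: "nw (For x h c) = insert x (nw c)" and rw_For [simp]: "rw (For x h c) = rw c"
  by (auto simp: For_def)

text \<open>Each step receives the frame relative to the initial state \<open>s\<close>, so what the
  loop does not write can stay out of \<open>I\<close>. The increment follows the body, hence the
  updated state in the postcondition of the step.\<close>

lemma runs_For:
  assumes K: "nmem s h 0 = K" "K \<le> N" and names: "h \<notin> nw c" "h \<noteq> x" "x \<notin> nw c"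
    and I0: "I 0 (nupd x 0 0 s)"
    and step: "\<And>k s'. \<lbrakk>k < K; frame (insert x (nw c)) (rw c) s s'; nmem s' x 0 = k; I k s'\<rbrakk>
       \<Longrightarrow> runs N c s' (\<lambda>s''. I (Suc k) (nupd x 0 (Suc k) s''))"
    and fin: "\<And>s'. \<lbrakk>frame (insert x (nw c)) (rw c) s s'; I K s'\<rbrakk> \<Longrightarrow> Q s'"
  shows "runs N (For x h c) s Q"
proof -
  let ?F = "frame (insert x (nw c)) (rw c) s"
  let ?J = "\<lambda>k s'. ?F s' \<and> nmem s' x 0 = k \<and> I k s'"
  let ?c = "Seq c (x ::= NAdd (V x) (NConst 1))"
  let ?b = "NLess (V x) (V h)"
  have h: "nmem s' h 0 = K" if "?F s'" for s'
    using that K(1) names by (auto simp: frame_def)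
  have st: "bval ?b s' \<and> (\<exists>t s''. exec ?c s' t s'' \<and> t \<le> tb N ?c \<and> ?J (Suc k) s'')"
    if k: "k < K" and J: "?J k s'" for k s'
  proof
    show "bval ?b s'" using k J h[of s'] by simp
    have "runs N ?c s' (?J (Suc k))"
      apply (rule runs_Seq[OF step[OF k]])
      using J names by (auto intro!: runs_NAssign simp: frame_def)
    then show "\<exists>t s''. exec ?c s' t s'' \<and> t \<le> tb N ?c \<and> ?J (Suc k) s''" by (simp add: runs_def)
  qed
  have "?J 0 (nupd x 0 0 s)" using I0 by (auto simp: frame_def)
  moreover have "\<not> bval ?b s'" if "?J K s'" for s' using that h[of s'] by simp
  ultimately have "\<exists>t s'. exec (While ?b ?c) (nupd x 0 0 s) t s' \<and>
      t \<le> (K - 0 + 1) * (bcost ?b + 1 + tb N ?c) \<and> ?J K s'"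
    by (intro exec_While_count[of 0 K ?J, OF le0 _ st])
  then obtain t s' where w: "exec (While ?b ?c) (nupd x 0 0 s) t s'"
    "t \<le> (K + 1) * (bcost ?b + 1 + tb N ?c)" "?J K s'"
    by (metis diff_zero)
  \<comment> \<open>The loop makes exactly \<open>K\<close> iterations, and this is the place where
    \<open>K <= N\<close> turns into the bound of \<open>tb\<close>.\<close>
  have "(K + 1) * (bcost ?b + 1 + tb N ?c) \<le> tb N (While ?b ?c)"
    unfolding tb.simps using K(2) by (intro mult_right_mono) auto
  with w(2) have "t \<le> tb N (While ?b ?c)" by linarith
  then have "runs N (While ?b ?c) (nupd x 0 0 s) (?J K)" using w unfolding runs_def by blast
  then have "runs N (For x h c) s (?J K)"
    unfolding For_def by (intro runs_Seq_wp runs_NAssign) simp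
  then show ?thesis by (rule runs_mono) (use fin in blast)
qed

text \<open>One pattern for two purposes: \<open>Rows\<close> and \<open>Cols\<close> want the list
  in \<open>r\<close>, \<open>Mis\<close> wants only its length in \<open>c\<close> and uses
  \<open>r\<close> as scratch space.\<close>

definition Filter :: "string \<Rightarrow> string \<Rightarrow> string \<Rightarrow> string \<Rightarrow> com \<Rightarrow> bexp \<Rightarrow> com" where
  "Filter r c i h pre b =
     Seq (c ::= NConst 0)
       (For i h (Seq pre
          (Cond b (Seq (NAssign r (V c) (V i)) (c ::= NAdd (V c) (NConst 1))) Skip)))"

lemma nw_Filter [simp]: "nw (Filter r c i h pre b) = {r, c, i} \<union> nw pre"
  and rw_Filter [simp]: "rw (Filter r c i h pre b) = rw pre"
  by (auto simp: Filter_def)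

lemma runs_Filter:
  assumes K: "nmem s h 0 = K" "K \<le> N"
    and names: "distinct [r, c, i, h]" "r \<notin> nw pre" "c \<notin> nw pre" "i \<notin> nw pre" "h \<notin> nw pre"
    and step: "\<And>k s'. \<lbrakk>k < K; frame ({r, c, i} \<union> nw pre) (rw pre) s s'; nmem s' i 0 = k\<rbrakk>
       \<Longrightarrow> runs N pre s' (\<lambda>s''. bval b s'' = P k)"
  shows "runs N (Filter r c i h pre b) s
    (\<lambda>s'. nmem s' c 0 = length (filter P [0..<K]) \<and>
          (\<forall>k < length (filter P [0..<K]). nmem s' r k = filter P [0..<K] ! k))"
  unfolding Filter_def
  apply (rule runs_Seq_wp, rule runs_NAssign)
  apply (rule runs_For[where K = K and I = "\<lambda>l s'. nmem s' c 0 = length (filter P [0..<l]) \<and>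
          (\<forall>k < length (filter P [0..<l]). nmem s' r k = filter P [0..<l] ! k)"])
  using K names apply (auto)[6]
   apply (rule runs_Seq)
    apply (rule step)
      apply assumption
     apply (use names in \<open>auto simp: frame_def\<close>)[1]
    apply assumption
   apply (rule runs_Cond)
    apply (rule runs_Seq_wp runs_NAssign)+
    apply (use names in \<open>auto simp: frame_def nth_append less_Suc_eq\<close>)[1]
   apply (rule runs_Skip)
   apply (use names in \<open>auto simp: frame_def\<close>)[2]
  done

lemma length_filter_upt: "length (filter P [0..<m]) = card {i. i < m \<and> P i}"
  by (auto simp: length_filter_conv_card intro!: arg_cong[where f = card])

text \<open>The count is kept as a real number because counts have to be multiplied later, and the
  machine multiplies only reals.\<close>

definition RCount :: "string \<Rightarrow> string \<Rightarrow> string \<Rightarrow> com \<Rightarrow> bexp \<Rightarrow> com" where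
  "RCount r i h pre b =
     Seq (RAssign r (NConst 0) RZero)
       (For i h (Seq pre (Cond b (RAssign r (NConst 0) (RAdd (RArr r (NConst 0)) ROne)) Skip)))"

lemma nw_RCount [simp]: "nw (RCount r i h pre b) = insert i (nw pre)"
  and rw_RCount [simp]: "rw (RCount r i h pre b) = insert r (rw pre)"
  by (auto simp: RCount_def)

lemma runs_RCount:
  assumes K: "nmem s h 0 = K" "K \<le> N"
    and names: "i \<noteq> h" "i \<notin> nw pre" "h \<notin> nw pre" "r \<notin> rw pre"
    and step: "\<And>k s'. \<lbrakk>k < K; frame (insert i (nw pre)) (insert r (rw pre)) s s'; nmem s' i 0 = k\<rbrakk>
       \<Longrightarrow> runs N pre s' (\<lambda>s''. bval b s'' = P k)"
  shows "runs N (RCount r i h pre b) s (\<lambda>s'. rmem s' r 0 = real (card {k. k < K \<and> P k}))"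
  unfolding RCount_def length_filter_upt[symmetric]
  apply (rule runs_Seq_wp, rule runs_RAssign)
  apply (rule runs_For[where K = K and I = "\<lambda>l s'. rmem s' r 0 = real (length (filter P [0..<l]))"])
  using K names apply (auto)[6]
   apply (rule runs_Seq)
    apply (rule step)
      apply assumption
     apply (use names in \<open>auto simp: frame_def\<close>)[1]
    apply assumption
   apply (rule runs_Cond)
    apply (rule runs_RAssign)
    apply (use names in \<open>auto simp: frame_def\<close>)[1]
   apply (rule runs_Skip)
   apply (use names in \<open>auto simp: frame_def\<close>)[2]
  done

section \<open>Factorisations of column counts\<close>

text \<open>The vector \<open>u\<close> is a row of \<open>c\<close> divided by its gcd; then \<open>v b\<close> is the gcd of row \<open>b\<close>.\<close>

lemma rank_one_nat_factor:
  fixes c :: "'a \<Rightarrow> 'b \<Rightarrow> nat"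
  assumes b0: "b0 \<in> Q" and pos: "\<And>a b. a \<in> P \<Longrightarrow> b \<in> Q \<Longrightarrow> 0 < c a b"
    and rank: "\<And>a a' b b'. \<lbrakk>a \<in> P; a' \<in> P; b \<in> Q; b' \<in> Q\<rbrakk> \<Longrightarrow> c a b * c a' b' = c a b' * c a' b"
  shows "\<exists>u v. \<forall>a\<in>P. \<forall>b\<in>Q. c a b = u a * v b"
proof -
  define g where "g = Gcd ((\<lambda>a. c a b0) ` P)"
  define u where "u a = c a b0 div g" for a
  define v where "v b = Gcd ((\<lambda>a. c a b) ` P)" for b
  have gu: "c a b0 = g * u a" if "a \<in> P" for a
    using that by (simp add: u_def g_def Gcd_dvd)
  have "c a b = u a * v b" if a: "a \<in> P" and b: "b \<in> Q" for a b
  proof -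
    have g: "g > 0" using gu[OF a] pos[OF a b0] by (cases g) auto
    \<comment> \<open>The entries of \<open>u\<close> are coprime: \<open>g\<close> times their gcd
      is again \<open>g\<close>, and \<open>g\<close> is positive.\<close>
    have "g = Gcd ((*) g ` u ` P)"
      unfolding image_image g_def[symmetric] by (subst (1) g_def, rule arg_cong[where f = Gcd]) (use gu in auto)
    also have "\<dots> = g * Gcd (u ` P)" by (simp only: Gcd_mult normalize_nat_def id_apply)
    finally have 1: "Gcd (u ` P) = 1" using g by simp
    \<comment> \<open>The rank condition with column \<open>b0\<close>, divided by \<open>g\<close>.
      Taking the gcd over all \<open>a'\<close> on both sides then leaves
      \<open>c a b = u a * v b\<close>.\<close>
    have "c a b * u a' = u a * c a' b" if a': "a' \<in> P" for a'
    proof -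
      have "g * (c a b * u a') = g * (u a * c a' b)"
        using rank[OF a a' b b0] gu[OF a] gu[OF a'] by (simp add: ac_simps)
      then show ?thesis using g by simp
    qed
    then have "(*) (c a b) ` u ` P = (*) (u a) ` (\<lambda>a. c a b) ` P"
      by (auto simp: image_image)
    then have "Gcd ((*) (c a b) ` u ` P) = Gcd ((*) (u a) ` (\<lambda>a. c a b) ` P)" by simp
    then show ?thesis by (simp only: Gcd_mult normalize_nat_def id_apply 1 v_def mult_1_right)
  qed
  then show ?thesis by blast
qed

lemma card_eq_sum_fibres:
  assumes "finite S" "finite T" "f ` S \<subseteq> T"
  shows "card S = (\<Sum>a\<in>T. card {x \<in> S. f x = a})"
  using sum.group[OF assms, of "\<lambda>_. 1::nat"] by simp

text \<open>An index \<open>a * n2 + b\<close> is decoded by \<open>div\<close> and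
  \<open>mod\<close>, so conditions on the two factors of a 1-product count independently.\<close>

lemma card_div_mod:
  fixes n1 n2 :: nat
  shows "card {j. j < n1 * n2 \<and> P (j div n2) \<and> Q (j mod n2)} =
    card {a. a < n1 \<and> P a} * card {b. b < n2 \<and> Q b}"
proof -
  have lt: "a * n2 + b < n1 * n2" if "a < n1" "b < n2" for a b
  proof -
    have "a * n2 + b < Suc a * n2" using that by simp
    also have "\<dots> \<le> n1 * n2" using that by (intro mult_right_mono) auto
    finally show ?thesis .
  qed
  have md: "j mod n2 < n2" if "j < n1 * n2" for j
    using that by (cases n2) auto
  have "bij_betw (\<lambda>(a, b). a * n2 + b) ({a. a < n1 \<and> P a} \<times> {b. b < n2 \<and> Q b})
     {j. j < n1 * n2 \<and> P (j div n2) \<and> Q (j mod n2)}"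
    by (rule bij_betw_byWitness[where f' = "\<lambda>j. (j div n2, j mod n2)"])
      (auto simp: lt less_mult_imp_div_less md)
  from bij_betw_same_card[OF this] show ?thesis by (simp add: card_cartesian_product)
qed

section \<open>Thinning the classes of a function\<close>

definition rank :: "(nat \<Rightarrow> 'a) \<Rightarrow> nat \<Rightarrow> nat" where
  "rank f j = card {l. l < j \<and> f l = f j}"

text \<open>Ranks start at 0, so for positive \<open>d\<close> a class of \<open>s\<close> indices
  contributes the ceiling of \<open>s / d\<close> of them.\<close>

definition thin :: "(nat \<Rightarrow> 'a) \<Rightarrow> nat \<Rightarrow> nat \<Rightarrow> nat list" where
  "thin f d n = filter (\<lambda>j. rank f j mod d = 0) [0..<n]"

lemma card_less_Suc_conj:
  "card {j. j < Suc n \<and> P j} = card {j. j < n \<and> P j} + (if P n then 1 else 0)"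
proof -
  have "{j. j < Suc n \<and> P j} = (if P n then insert n {j. j < n \<and> P j} else {j. j < n \<and> P j})"
    by (auto simp: less_Suc_eq)
  then show ?thesis by simp
qed

text \<open>The two inequalities characterise \<open>s\<close> as the ceiling of
  \<open>c / d\<close>, and this ceiling goes up from \<open>c\<close> to \<open>c + 1\<close>
  exactly when \<open>d\<close> divides \<open>c\<close>.\<close>

lemma ceiling_quotient_Suc:
  fixes c s d :: nat
  assumes d: "0 < d" and le: "c \<le> d * s" and less: "d * s < c + d"
  shows "c + 1 \<le> d * (s + (if c mod d = 0 then 1 else 0)) \<and>
    d * (s + (if c mod d = 0 then 1 else 0)) < c + 1 + d"
proof (cases "c mod d = 0")
  case True
  then obtain k where k: "c = d * k" by (auto simp: mod_eq_0_iff_dvd)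
  have "d * s < d * Suc k" using less k by simp
  then have "s = k" using le d unfolding k by (simp only: mult_le_cancel1 mult_less_cancel1) linarith
  then show ?thesis using True d k by simp
next
  case False
  then have "d * s \<noteq> c" by (metis mod_mult_self1_is_0)
  then show ?thesis using False le less by simp
qed

text \<open>By induction on \<open>n\<close>: the rank of a new member is the size of its class so
  far, so it is kept exactly when the ceiling goes up.\<close>

lemma thin_class_bounds:
  assumes "0 < d"
  shows "card {j. j < n \<and> f j = a} \<le> d * card {j. j < n \<and> f j = a \<and> rank f j mod d = 0} \<and>
    d * card {j. j < n \<and> f j = a \<and> rank f j mod d = 0} < card {j. j < n \<and> f j = a} + d"
proof (induction n)
  case 0
  show ?case using assms by simp
next
  case (Suc n)
  let ?c = "card {j. j < n \<and> f j = a}" and ?s = "card {j. j < n \<and> f j = a \<and> rank f j mod d = 0}"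
  have C: "card {j. j < Suc n \<and> f j = a} = ?c + (if f n = a then 1 else 0)"
    by (rule card_less_Suc_conj)
  have S: "card {j. j < Suc n \<and> f j = a \<and> rank f j mod d = 0} =
      ?s + (if f n = a \<and> rank f n mod d = 0 then 1 else 0)"
    by (rule card_less_Suc_conj)
  show ?case
  proof (cases "f n = a")
    case True
    then have r: "rank f n = ?c" by (simp add: rank_def)
    have "(f n = a) = True" using True by simp
    then show ?thesis unfolding C S r
      using ceiling_quotient_Suc[OF assms conjunct1[OF Suc] conjunct2[OF Suc]] by (simp only: simp_thms if_True)
  next
    case False
    then show ?thesis unfolding C S using Suc by (simp only: if_False add_0_right simp_thms)
  qed
qed

lemma thin_class_eq:
  assumes "0 < d" and "card {j. j < n \<and> f j = a} = d * u"
  shows "card {j. j < n \<and> f j = a \<and> rank f j mod d = 0} = u"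
proof -
  let ?s = "card {j. j < n \<and> f j = a \<and> rank f j mod d = 0}"
  have "d * u \<le> d * ?s" "d * ?s < d * Suc u" using thin_class_bounds[OF assms(1), of n f a] assms(2) by auto
  then have "u \<le> ?s" "?s < Suc u" using assms(1) by (simp_all only: mult_le_cancel1 mult_less_cancel1)
  then show ?thesis by linarith
qed

lemma length_thin:
  "length (thin f d n) = (\<Sum>a\<in>f ` {..<n}. card {j. j < n \<and> f j = a \<and> rank f j mod d = 0})"
proof -
  have "length (thin f d n) = card {j. j < n \<and> rank f j mod d = 0}"
    by (simp add: thin_def length_filter_upt)
  also have "\<dots> = (\<Sum>a\<in>f ` {..<n}. card {x \<in> {j. j < n \<and> rank f j mod d = 0}. f x = a})"
    by (intro card_eq_sum_fibres) auto
  also have "\<dots> = (\<Sum>a\<in>f ` {..<n}. card {j. j < n \<and> f j = a \<and> rank f j mod d = 0})"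
    by (intro sum.cong arg_cong[where f = card]) auto
  finally show ?thesis .
qed

lemma length_thin_eq:
  assumes "0 < d" and "\<And>j. j < n \<Longrightarrow> card {l. l < n \<and> f l = f j} = d * u (f j)"
  shows "length (thin f d n) = (\<Sum>a\<in>f ` {..<n}. u a)"
  unfolding length_thin
proof (rule sum.cong[OF refl])
  fix a assume "a \<in> f ` {..<n}"
  then obtain j where "j < n" "a = f j" by blast
  then have "card {l. l < n \<and> f l = a} = d * u a" using assms(2)[of j] by simp
  then show "card {j. j < n \<and> f j = a \<and> rank f j mod d = 0} = u a"
    by (rule thin_class_eq[OF assms(1)])
qed

text \<open>Rounding up gives one inequality in every class; equality of the totals forces equality
  in each. So a single comparison of lengths certifies that \<open>d\<close> divides all class
  sizes.\<close>

lemma thin_class_exact: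
  assumes d: "0 < d" and len: "d * length (thin f d n) = n"
  shows "d * card {j. j < n \<and> f j = a \<and> rank f j mod d = 0} = card {j. j < n \<and> f j = a}"
proof (cases "a \<in> f ` {..<n}")
  case True
  let ?s = "\<lambda>a. d * card {j. j < n \<and> f j = a \<and> rank f j mod d = 0}" and ?c = "\<lambda>a. card {j. j < n \<and> f j = a}"
  have "n = card {..<n}" by simp
  also have "\<dots> = (\<Sum>a\<in>f ` {..<n}. card {x \<in> {..<n}. f x = a})"
    by (intro card_eq_sum_fibres) auto
  also have "\<dots> = (\<Sum>a\<in>f ` {..<n}. ?c a)"
    by (intro sum.cong arg_cong[where f = card]) auto
  finally have "(\<Sum>a\<in>f ` {..<n}. ?c a) = (\<Sum>a\<in>f ` {..<n}. ?s a)"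
    using len by (simp add: length_thin sum_distrib_left)
  moreover have "?c b \<le> ?s b" for b using thin_class_bounds[OF d, of n f b] by blast
  ultimately have "\<not> ?c a < ?s a"
    using sum_strict_mono_ex1[of "f ` {..<n}" ?c ?s] True by fastforce
  then show ?thesis using thin_class_bounds[OF d, of n f a] by linarith
next
  case False
  then have "{j. j < n \<and> f j = a} = {}" "{j. j < n \<and> f j = a \<and> rank f j mod d = 0} = {}" by auto
  then show ?thesis by (simp only: card.empty mult_0_right)
qed

section \<open>Column counts and violating pairs\<close>

definition mix :: "nat set \<Rightarrow> (nat \<Rightarrow> 'a) \<Rightarrow> (nat \<Rightarrow> 'a) \<Rightarrow> nat \<Rightarrow> 'a" where
  "mix A x y i = (if i \<in> A then x i else y i)"

text \<open>\<open>X j i\<close> is the entry of column \<open>j\<close> in row \<open>i\<close>.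
  Columns are total functions, so that mixtures which are not columns have the same type; only rows
  below \<open>m\<close> are significant.\<close>

locale columns =
  fixes m n :: nat and X :: "nat \<Rightarrow> nat \<Rightarrow> 'a"
begin

text \<open>A canonical representative of the restriction of \<open>z\<close> to the rows in \<open>A\<close>.\<close>

definition part :: "nat set \<Rightarrow> (nat \<Rightarrow> 'a) \<Rightarrow> nat \<Rightarrow> 'a" where
  "part A z i = (if i < m \<and> i \<in> A then z i else undefined)"

lemma part_eq_iff: "part A z = part A z' \<longleftrightarrow> (\<forall>i<m. i \<in> A \<longrightarrow> z i = z' i)"
  by (auto simp: part_def fun_eq_iff)

definition cnt :: "(nat \<Rightarrow> 'a) \<Rightarrow> nat" where
  "cnt z = card {j. j < n \<and> (\<forall>i<m. X j i = z i)}"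

lemma cnt_pos_iff: "0 < cnt z \<longleftrightarrow> (\<exists>j<n. \<forall>i<m. X j i = z i)"
  by (auto simp: cnt_def card_gt_0_iff)

lemma cnt_cong: "(\<And>i. i < m \<Longrightarrow> z i = z' i) \<Longrightarrow> cnt z = cnt z'"
  by (simp add: cnt_def)

lemma cnt_column_pos: "j < n \<Longrightarrow> 0 < cnt (X j)"
  by (auto simp: cnt_pos_iff)

text \<open>The equation ranges over all vectors, so through zero counts it also records which
  combinations of partial columns are absent.\<close>

definition factors :: "nat set \<Rightarrow> bool" where
  "factors A \<longleftrightarrow> (\<exists>c1 c2. \<forall>z. cnt z = c1 (part A z) * c2 (part (- A) z))"

definition viol :: "nat set \<Rightarrow> nat \<Rightarrow> nat \<Rightarrow> bool" where
  "viol A x y \<longleftrightarrow>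
     cnt (X x) * cnt (X y) \<noteq> cnt (mix A (X x) (X y)) * cnt (mix A (X y) (X x))"

definition gap :: "nat set \<Rightarrow> nat \<Rightarrow> nat \<Rightarrow> nat set" where
  "gap A x y = {i. i < m \<and> i \<notin> A \<and> X x i \<noteq> X y i}"

lemma finite_gap [simp]: "finite (gap A x y)"
  by (simp add: gap_def)

lemma card_gap_le: "card (gap A x y) \<le> m"
  using card_mono[of "{..<m}" "gap A x y"] by (auto simp: gap_def)

text \<open>If the columns agree outside \<open>A\<close>, mixing them only gives them back. This
  makes every growth step add a row.\<close>

lemma viol_gap: "viol A x y \<Longrightarrow> gap A x y \<noteq> {}"
proof
  assume v: "viol A x y" and g: "gap A x y = {}"
  have "cnt (mix A (X x) (X y)) = cnt (X x)" "cnt (mix A (X y) (X x)) = cnt (X y)"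
    using g by (auto intro!: cnt_cong simp: gap_def mix_def)
  with v show False by (simp add: viol_def)
qed

text \<open>If a row of the gap lay outside \<open>A'\<close>, the column \<open>y'\<close> that
  follows \<open>y\<close> on \<open>A'\<close> and \<open>x\<close> elsewhere would form with
  \<open>x\<close> a violating pair of smaller gap.\<close>

lemma minimal_violation:
  assumes "factors A'" "A \<subseteq> A'" and xy: "x < n" "y < n" and v: "viol A x y"
    and min: "\<And>x' y'. \<lbrakk>x' < n; y' < n; viol A x' y'\<rbrakk> \<Longrightarrow> card (gap A x y) \<le> card (gap A x' y')"
  shows "gap A x y \<subseteq> A'"
proof (rule ccontr)
  assume "\<not> gap A x y \<subseteq> A'"
  then obtain i0 where i0: "i0 \<in> gap A x y" "i0 \<notin> A'" by blast
  obtain c1 c2 where c: "\<And>z. cnt z = c1 (part A' z) * c2 (part (- A') z)"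
    using assms(1) by (auto simp: factors_def)
  let ?w = "mix A' (X y) (X x)"
  have w1: "part A' ?w = part A' (X y)" and w2: "part (- A') ?w = part (- A') (X x)"
    by (auto simp: part_eq_iff mix_def)
  \<comment> \<open>Both factors of this count also divide the positive counts of \<open>X y\<close>
    and \<open>X x\<close>, so the mixture really occurs as a column.\<close>
  have "0 < cnt ?w" using cnt_column_pos[OF xy(1)] cnt_column_pos[OF xy(2)] by (simp add: c w1 w2)
  then obtain y' where y': "y' < n" "\<And>i. i < m \<Longrightarrow> X y' i = ?w i" by (auto simp: cnt_pos_iff)
  \<comment> \<open>As \<open>A\<close> lies in \<open>A'\<close>, mixing over \<open>A\<close> only
    exchanges the parts on \<open>- A'\<close>. The positive \<open>c2\<close> factors therefore
    cancel in both violation tests, and the same inequality between \<open>c1\<close> values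
    remains.\<close>
  have e: "part A' (X y') = part A' (X y)" "part (- A') (X y') = part (- A') (X x)"
    "part A' (mix A (X x) (X y')) = part A' (mix A (X x) (X y))"
    "part (- A') (mix A (X x) (X y')) = part (- A') (X x)"
    "part A' (mix A (X y') (X x)) = part A' (mix A (X y) (X x))"
    "part (- A') (mix A (X y') (X x)) = part (- A') (X x)"
    "part (- A') (mix A (X x) (X y)) = part (- A') (X y)"
    "part (- A') (mix A (X y) (X x)) = part (- A') (X x)"
    using assms(2) y'(2) by (auto simp: part_eq_iff mix_def)
  have "viol A x y'"
    using v cnt_column_pos[OF xy(1)] cnt_column_pos[OF xy(2)] unfolding viol_def c e by auto
  then have "card (gap A x y) \<le> card (gap A x y')" using min xy y' by blast
  moreover have "gap A x y' \<subset> gap A x y"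
  proof
    show "gap A x y' \<subseteq> gap A x y" using y'(2) by (auto simp: gap_def mix_def split: if_splits)
    have "i0 \<notin> gap A x y'" using i0 y'(2) by (auto simp: gap_def mix_def)
    with i0 show "gap A x y' \<noteq> gap A x y" by blast
  qed
  ultimately show False by (meson finite_gap leD psubset_card_mono)
qed

definition no_viol :: "nat set \<Rightarrow> bool" where
  "no_viol A \<longleftrightarrow> (\<forall>x<n. \<forall>y<n. \<not> viol A x y)"

text \<open>Without violations the counts form a rank one matrix indexed by the occurring partial
  columns. Summing over one index makes the class sizes multiples of \<open>sum v Q\<close> and of
  \<open>sum u P\<close>, as thinning requires.\<close>

lemma no_viol_factorisation:
  assumes nv: "no_viol A"
  defines "P \<equiv> (\<lambda>j. part A (X j)) ` {..<n}" and "Q \<equiv> (\<lambda>j. part (- A) (X j)) ` {..<n}"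
  shows "\<exists>u v.
    (\<forall>x<n. \<forall>y<n. cnt (mix A (X x) (X y)) = u (part A (X x)) * v (part (- A) (X y))) \<and>
    sum u P * sum v Q = n \<and>
    (\<forall>x<n. card {j. j < n \<and> part A (X j) = part A (X x)} = sum v Q * u (part A (X x))) \<and>
    (\<forall>y<n. card {j. j < n \<and> part (- A) (X j) = part (- A) (X y)} = sum u P * v (part (- A) (X y)))"
proof -
  have mp: "cnt (mix A (part A x) (part (- A) y)) = cnt (mix A x y)" for x y
    by (intro cnt_cong) (auto simp: mix_def part_def)
  \<comment> \<open>The product of the two mixed counts equals a product of positive counts, so all
    mixtures occur.\<close>
  have pos: "0 < cnt (mix A (X x) (X y))" if "x < n" "y < n" for x y
    using nv[unfolded no_viol_def viol_def, rule_format, OF that] cnt_column_pos[OF that(1)] cnt_column_pos[OF that(2)]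
    by (metis not_gr_zero mult_eq_0_iff)
  have "\<exists>u v. \<forall>a\<in>P. \<forall>b\<in>Q. cnt (mix A a b) = u a * v b" if n: "0 < n"
  proof (rule rank_one_nat_factor)
    show "part (- A) (X 0) \<in> Q" using n by (auto simp: Q_def)
    show "0 < cnt (mix A a b)" if "a \<in> P" "b \<in> Q" for a b
      using that pos by (auto simp: P_def Q_def mp)
    show "cnt (mix A a b) * cnt (mix A a' b') = cnt (mix A a b') * cnt (mix A a' b)"
      if ab: "a \<in> P" "a' \<in> P" "b \<in> Q" "b' \<in> Q" for a a' b b'
    proof -
      obtain x x' y y' where x: "x < n" "x' < n" "y < n" "y' < n" "a = part A (X x)" "a' = part A (X x')"
        "b = part (- A) (X y)" "b' = part (- A) (X y')"
        using ab by (auto simp: P_def Q_def)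
      \<comment> \<open>Columns realising the two diagonal mixtures: mixing these two yields the
        off-diagonal ones, and the absence of a violation becomes the vanishing of the
        minor.\<close>
      obtain j where j: "j < n" "\<And>i. i < m \<Longrightarrow> X j i = mix A (X x) (X y) i"
        using pos[of x y] x by (auto simp: cnt_pos_iff)
      obtain l where l: "l < n" "\<And>i. i < m \<Longrightarrow> X l i = mix A (X x') (X y') i"
        using pos[of x' y'] x by (auto simp: cnt_pos_iff)
      have "cnt (X j) * cnt (X l) = cnt (mix A (X j) (X l)) * cnt (mix A (X l) (X j))"
        using nv j(1) l(1) by (simp add: no_viol_def viol_def)
      moreover have "cnt (X j) = cnt (mix A (X x) (X y))" "cnt (X l) = cnt (mix A (X x') (X y'))"
        "cnt (mix A (X j) (X l)) = cnt (mix A (X x) (X y'))"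
        "cnt (mix A (X l) (X j)) = cnt (mix A (X x') (X y))"
        using j l by (auto intro!: cnt_cong simp: mix_def)
      ultimately show ?thesis by (simp add: x mp)
    qed
  qed
  then obtain u v where uv: "\<And>a b. a \<in> P \<Longrightarrow> b \<in> Q \<Longrightarrow> cnt (mix A a b) = u a * v b"
    by (cases "n = 0") (auto simp: P_def Q_def)
  have cls: "card {j. j < n \<and> part A (X j) = a \<and> part (- A) (X j) = b} = u a * v b"
    if ab: "a \<in> P" "b \<in> Q" for a b
  proof -
    have "{j. j < n \<and> part A (X j) = a \<and> part (- A) (X j) = b} = {j. j < n \<and> (\<forall>i<m. X j i = mix A a b i)}"
      using ab by (auto simp: P_def Q_def part_eq_iff) (auto simp: mix_def part_def)
    then show ?thesis using uv[OF ab] by (simp add: cnt_def)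
  qed
  have cA: "card {j. j < n \<and> part A (X j) = a} = sum v Q * u a" if "a \<in> P" for a
  proof -
    have "card {j. j < n \<and> part A (X j) = a} =
       (\<Sum>b\<in>Q. card {j \<in> {j. j < n \<and> part A (X j) = a}. part (- A) (X j) = b})"
      by (intro card_eq_sum_fibres) (auto simp: Q_def)
    also have "\<dots> = (\<Sum>b\<in>Q. u a * v b)"
      using cls[OF that] by (intro sum.cong) auto
    finally show ?thesis by (simp add: sum_distrib_left mult.commute)
  qed
  have cB: "card {j. j < n \<and> part (- A) (X j) = b} = sum u P * v b" if "b \<in> Q" for b
  proof -
    have "card {j. j < n \<and> part (- A) (X j) = b} =
       (\<Sum>a\<in>P. card {j \<in> {j. j < n \<and> part (- A) (X j) = b}. part A (X j) = a})"
      by (intro card_eq_sum_fibres) (auto simp: P_def)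
    also have "\<dots> = (\<Sum>a\<in>P. u a * v b)"
      using cls[OF _ that] by (intro sum.cong refl) (simp add: conj_ac)
    finally show ?thesis by (simp add: sum_distrib_right)
  qed
  have "n = card {..<n}" by simp
  also have "\<dots> = (\<Sum>a\<in>P. card {j \<in> {..<n}. part A (X j) = a})"
    by (intro card_eq_sum_fibres) (auto simp: P_def)
  also have "\<dots> = (\<Sum>a\<in>P. sum v Q * u a)"
    using cA by (intro sum.cong) auto
  also have "\<dots> = sum u P * sum v Q"
    by (subst sum_distrib_right) (simp only: mult.commute)
  finally have N: "sum u P * sum v Q = n" by simp
  have "cnt (mix A (X x) (X y)) = u (part A (X x)) * v (part (- A) (X y))" if "x < n" "y < n" for x y
    using uv[of "part A (X x)" "part (- A) (X y)"] that by (auto simp: mp P_def Q_def)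
  moreover have "part A (X x) \<in> P" "part (- A) (X x) \<in> Q" if "x < n" for x
    using that by (auto simp: P_def Q_def)
  ultimately show ?thesis using N cA cB by (intro exI[of _ u] exI[of _ v]) simp
qed

abbreviation thinA :: "nat set \<Rightarrow> nat \<Rightarrow> nat list" where
  "thinA A d \<equiv> thin (\<lambda>j. part A (X j)) d n"

text \<open>The widths are the sums of \<open>u\<close> and \<open>v\<close>: they divide the
  respective class sizes, so thinning involves no rounding.\<close>

lemma ex_thin:
  assumes "no_viol A" and "0 < n"
  shows "\<exists>n1 n2. n1 * n2 = n \<and> length (thinA A n2) = n1 \<and> length (thinA (- A) n1) = n2"
proof -
  let ?P = "(\<lambda>j. part A (X j)) ` {..<n}" and ?Q = "(\<lambda>j. part (- A) (X j)) ` {..<n}"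
  obtain u v where N: "sum u ?P * sum v ?Q = n" and
    c: "\<forall>x<n. card {j. j < n \<and> part A (X j) = part A (X x)} = sum v ?Q * u (part A (X x))"
      "\<forall>y<n. card {j. j < n \<and> part (- A) (X j) = part (- A) (X y)} = sum u ?P * v (part (- A) (X y))"
    using no_viol_factorisation[OF assms(1)] by (elim exE conjE) (rule that)
  have "0 < sum u ?P * sum v ?Q" using N assms(2) by simp
  then have p: "0 < sum u ?P" "0 < sum v ?Q" by (simp_all only: nat_0_less_mult_iff)
  have "length (thinA A (sum v ?Q)) = sum u ?P"
    by (rule length_thin_eq[OF p(2)]) (use c(1) in blast)
  moreover have "length (thinA (- A) (sum u ?P)) = sum v ?Q"
    by (rule length_thin_eq[OF p(1)]) (use c(2) in blast)
  ultimately show ?thesis using N by blast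
qed

text \<open>Any widths that pass the length test work, even if they are not the sums of the chosen
  \<open>u\<close> and \<open>v\<close>: after multiplication by \<open>n\<close> both sides become
  the same product of class sizes.\<close>

lemma cnt_thin:
  assumes nv: "no_viol A" and n: "0 < n"
    and N: "n1 * n2 = n" and l1: "length (thinA A n2) = n1" and l2: "length (thinA (- A) n1) = n2"
  shows "cnt z = card {j. j < n \<and> part A (X j) = part A z \<and> rank (\<lambda>j. part A (X j)) j mod n2 = 0} *
     card {j. j < n \<and> part (- A) (X j) = part (- A) z \<and> rank (\<lambda>j. part (- A) (X j)) j mod n1 = 0}"
    (is "_ = ?s1 * ?s2")
proof -
  have "0 < n1 * n2" using N n by simp
  then have p: "0 < n1" "0 < n2" by (simp_all only: nat_0_less_mult_iff)
  have s: "n2 * ?s1 = card {j. j < n \<and> part A (X j) = part A z}"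
    "n1 * ?s2 = card {j. j < n \<and> part (- A) (X j) = part (- A) z}"
    using p N l1 l2 by (intro thin_class_exact; simp add: mult.commute)+
  show ?thesis
  proof (cases "(\<exists>x<n. part A (X x) = part A z) \<and> (\<exists>y<n. part (- A) (X y) = part (- A) z)")
    case True
    then obtain x y where xy: "x < n" "y < n" "part A (X x) = part A z" "part (- A) (X y) = part (- A) z"
      by blast
    let ?P = "(\<lambda>j. part A (X j)) ` {..<n}" and ?Q = "(\<lambda>j. part (- A) (X j)) ` {..<n}"
    obtain u v where uv:
      "\<forall>x<n. \<forall>y<n. cnt (mix A (X x) (X y)) = u (part A (X x)) * v (part (- A) (X y))"
      "sum u ?P * sum v ?Q = n"
      "\<forall>x<n. card {j. j < n \<and> part A (X j) = part A (X x)} = sum v ?Q * u (part A (X x))"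
      "\<forall>y<n. card {j. j < n \<and> part (- A) (X j) = part (- A) (X y)} = sum u ?P * v (part (- A) (X y))"
      using no_viol_factorisation[OF nv] by (elim exE conjE) (rule that)
    have "cnt z = cnt (mix A (X x) (X y))"
      using xy(3,4) by (intro cnt_cong) (auto simp: mix_def part_eq_iff)
    also have "\<dots> = u (part A z) * v (part (- A) z)" using uv(1)[rule_format, OF xy(1,2)] by (simp only: xy(3,4))
    finally have c: "cnt z = u (part A z) * v (part (- A) z)" .
    have s': "n2 * ?s1 = sum v ?Q * u (part A z)" "n1 * ?s2 = sum u ?P * v (part (- A) z)"
      unfolding s using uv(3)[rule_format, OF xy(1)] uv(4)[rule_format, OF xy(2)] by (simp_all only: xy(3,4))
    have "n * (?s1 * ?s2) = (n2 * ?s1) * (n1 * ?s2)" by (simp only: N[symmetric] ac_simps)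
    also have "\<dots> = (sum u ?P * sum v ?Q) * cnt z" by (simp only: s' c ac_simps)
    also have "\<dots> = n * cnt z" by (simp only: uv(2))
    finally show ?thesis using n by simp
  next
    \<comment> \<open>One of the two parts of \<open>z\<close> occurs in no column, so both sides
      are 0.\<close>
    case False
    have "\<not> 0 < cnt z" using False unfolding cnt_pos_iff part_eq_iff by blast
    moreover have "n2 * ?s1 = 0 \<or> n1 * ?s2 = 0" using False unfolding s by (auto simp: card_eq_0_iff)
    ultimately show ?thesis using p by auto
  qed
qed

text \<open>The combined columns and the original ones have the same multiplicity at every vector,
  so they form the same multiset and differ by a permutation of indices.\<close>

lemma thin_columns_permute:
  assumes nv: "no_viol A" and n: "0 < n"
    and N: "n1 * n2 = n" and l1: "length (thinA A n2) = n1" and l2: "length (thinA (- A) n1) = n2"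
  obtains q where "q permutes {..<n}"
    "\<And>i j. i < m \<Longrightarrow> j < n \<Longrightarrow>
       mix A (X (thinA A n2 ! (j div n2))) (X (thinA (- A) n1 ! (j mod n2))) i = X (q j) i"
proof -
  let ?h = "\<lambda>j. mix A (X (thinA A n2 ! (j div n2))) (X (thinA (- A) n1 ! (j mod n2)))"
  \<comment> \<open>\<open>part UNIV\<close> erases the values at rows from \<open>m\<close> on, so
    agreement on the rows below \<open>m\<close> becomes equality of functions.\<close>
  let ?f = "\<lambda>j. part UNIV (X j)" and ?g = "\<lambda>j. part UNIV (?h j)"
  \<comment> \<open>Passes from positions in a thinned list to the column indices stored
    there.\<close>
  have fc: "card {a. a < length (thin f d n) \<and> P (thin f d n ! a)} = card {j. j < n \<and> P j \<and> rank f j mod d = 0}"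
    for f :: "nat \<Rightarrow> nat \<Rightarrow> 'a" and d P
    unfolding length_filter_conv_card[symmetric] by (simp add: thin_def length_filter_upt conj_commute)
  have "card {j. j < n \<and> ?g j = z} = card {j. j < n \<and> ?f j = z}" for z
  proof (cases "z = part UNIV z")
    case True
    have iff: "part UNIV w = z \<longleftrightarrow> (\<forall>i<m. w i = z i)" for w
      by (subst True) (simp add: part_eq_iff)
    have "card {j. j < n \<and> ?g j = z} = card {j. j < n1 * n2 \<and>
        part A (X (thinA A n2 ! (j div n2))) = part A z \<and>
        part (- A) (X (thinA (- A) n1 ! (j mod n2))) = part (- A) z}"
      unfolding N iff by (intro arg_cong[where f = card]) (auto simp: part_eq_iff mix_def)
    also have "\<dots> = card {a. a < n1 \<and> part A (X (thinA A n2 ! a)) = part A z} *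
        card {b. b < n2 \<and> part (- A) (X (thinA (- A) n1 ! b)) = part (- A) z}"
      by (rule card_div_mod)
    also have "\<dots> = cnt z"
      using cnt_thin[OF nv n N l1 l2, of z] fc[of "\<lambda>j. part A (X j)" n2 "\<lambda>a. part A (X a) = part A z"]
        fc[of "\<lambda>j. part (- A) (X j)" n1 "\<lambda>a. part (- A) (X a) = part (- A) z"] l1 l2 by simp
    finally show ?thesis by (simp add: cnt_def iff)
  next
    case False
    have "part UNIV (part UNIV w) = part UNIV w" for w by (simp add: part_eq_iff part_def)
    with False have "part UNIV w \<noteq> z" for w by metis
    then show ?thesis by simp
  qed
  then have "image_mset ?g (mset_set {..<n}) = image_mset ?f (mset_set {..<n})"
    by (intro multiset_eqI) (simp add: count_image_mset vimage_def Int_def conj_commute)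
  from image_mset_eq_implies_permutes[OF _ this] obtain q
    where q: "q permutes {..<n}" "\<forall>j\<in>{..<n}. ?g j = ?f (q j)" by auto
  show thesis by (rule that[OF q(1)]) (use q(2) in \<open>auto simp: part_eq_iff\<close>)
qed

end

section \<open>Factorisations and 1-products\<close>

lemma card_permutes_Collect:
  assumes "q permutes {..<n}"
  shows "card {j. j < n \<and> R (q j)} = card {j. j < n \<and> R j}"
proof -
  have "{j. j < n \<and> R j} = q ` {j. j < n \<and> R (q j)}"
  proof (intro equalityI subsetI)
    fix j assume j: "j \<in> {j. j < n \<and> R j}"
    then have "j \<in> q ` {..<n}" using permutes_image[OF assms] by simp
    with j show "j \<in> q ` {j. j < n \<and> R (q j)}" by auto
  next
    fix j assume "j \<in> q ` {j. j < n \<and> R (q j)}"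
    then show "j \<in> {j. j < n \<and> R j}" using permutes_in_image[OF assms] by auto
  qed
  then show ?thesis by (metis card_image inj_on_subset permutes_inj[OF assms] subset_UNIV)
qed

lemma all_permutes_iff:
  assumes "p permutes {..<m}"
  shows "(\<forall>i<m. R (p i)) \<longleftrightarrow> (\<forall>i<m. R i)"
  using permutes_image[OF assms] by (metis imageE image_eqI lessThan_iff)

context columns
begin

text \<open>Allows the block that contains row 0 to be the one considered.\<close>

lemma factors_compl:
  assumes "factors A"
  shows "factors ({..<m} - A)"
proof -
  have "part ({..<m} - A) z = part (- A) z" "part (- ({..<m} - A)) z = part A z" for z
    by (auto simp: part_def fun_eq_iff)
  with assms show ?thesis unfolding factors_def by (metis mult.commute)
qed

end

definition mcols :: "'a mat \<Rightarrow> nat \<Rightarrow> nat \<Rightarrow> 'a" where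
  "mcols S j i = S $$ (i, j)"

lemma all_less_add_iff:
  fixes m1 m2 :: nat
  shows "(\<forall>i<m1 + m2. R i) \<longleftrightarrow> (\<forall>i<m1. R i) \<and> (\<forall>i<m2. R (m1 + i))"
  by (metis add_diff_inverse_nat nat_add_left_cancel_less trans_less_add1)

text \<open>Up to the permutations, a column of \<open>S\<close> is a pair of columns of
  \<open>S1\<close> and \<open>S2\<close>, so its multiplicity is a product. Both factors have rows,
  hence each block is a proper subset.\<close>

lemma one_product_factors:
  assumes "is_one_product S"
  obtains A where "0 \<in> A" "A \<subset> {..<dim_row S}" "0 < dim_col S"
    "columns.factors (dim_row S) (dim_col S) (mcols S) A"
proof -
  obtain S1 S2 p q where ne: "nonempty_mat S1" "nonempty_mat S2"
    and p: "p permutes {..<dim_row S}" and q: "q permutes {..<dim_col S}"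
    and T: "S1 \<otimes>\<^sub>1 S2 = mat (dim_row S) (dim_col S) (\<lambda>(i, j). S $$ (p i, q j))"
    using assms by (auto simp: is_one_product_def matrix_iso_def)
  define m1 m2 n1 n2 where d: "m1 = dim_row S1" "m2 = dim_row S2" "n1 = dim_col S1" "n2 = dim_col S2"
  have pos: "0 < m1" "0 < m2" "0 < n1" "0 < n2" using ne by (auto simp: nonempty_mat_def d)
  have m: "dim_row S = m1 + m2" and n: "dim_col S = n1 * n2"
    using arg_cong[OF T, of dim_row] arg_cong[OF T, of dim_col] by (auto simp: one_prod_def d)
  interpret columns "m1 + m2" "n1 * n2" "mcols S" .
  note p = p[unfolded m] and q = q[unfolded n]
  have entry: "S $$ (p i, q j) = (if i < m1 then S1 $$ (i, j div n2) else S2 $$ (i - m1, j mod n2))"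
    if "i < m1 + m2" "j < n1 * n2" for i j
    using arg_cong[OF T, of "\<lambda>M. M $$ (i, j)"] that by (auto simp: one_prod_def m n d split: if_splits)
  \<comment> \<open>The isomorphism reads row \<open>p i\<close> of \<open>S\<close> as row
    \<open>i\<close> of the product, so these rows of \<open>S\<close> carry
    \<open>S1\<close>.\<close>
  let ?A = "p ` {..<m1}"
  have inj: "p i = p i' \<longleftrightarrow> i = i'" for i i' using permutes_inj[OF p] by (auto dest: injD)
  have lt: "p i < m1 + m2 \<longleftrightarrow> i < m1 + m2" for i using permutes_in_image[OF p, of i] by simp
  define c1 c2 where "c1 w = card {a. a < n1 \<and> (\<forall>i<m1. S1 $$ (i, a) = w (p i))}"
    and "c2 w = card {b. b < n2 \<and> (\<forall>i<m2. S2 $$ (i, b) = w (p (m1 + i)))}" for w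
  have "cnt z = c1 (part ?A z) * c2 (part (- ?A) z)" for z
  proof -
    have "cnt z = card {j. j < n1 * n2 \<and> (\<forall>i<m1 + m2. S $$ (i, q j) = z i)}"
      unfolding cnt_def mcols_def using card_permutes_Collect[OF q, of "\<lambda>j. \<forall>i<m1 + m2. S $$ (i, j) = z i"] by simp
    also have "\<dots> = card {j. j < n1 * n2 \<and> (\<forall>i<m1. S1 $$ (i, j div n2) = z (p i)) \<and>
        (\<forall>i<m2. S2 $$ (i, j mod n2) = z (p (m1 + i)))}"
    proof (intro arg_cong[where f = card] Collect_cong conj_cong refl)
      fix j assume j: "j < n1 * n2"
      have "(\<forall>i<m1 + m2. S $$ (i, q j) = z i) \<longleftrightarrow> (\<forall>i<m1 + m2. S $$ (p i, q j) = z (p i))"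
        using all_permutes_iff[OF p, of "\<lambda>i. S $$ (i, q j) = z i"] by simp
      also have "\<dots> \<longleftrightarrow> (\<forall>i<m1. S1 $$ (i, j div n2) = z (p i)) \<and>
        (\<forall>i<m2. S2 $$ (i, j mod n2) = z (p (m1 + i)))"
        unfolding all_less_add_iff using j by (simp add: entry)
      finally show "(\<forall>i<m1 + m2. S $$ (i, q j) = z i) \<longleftrightarrow> \<dots>" .
    qed
    also have "\<dots> = card {a. a < n1 \<and> (\<forall>i<m1. S1 $$ (i, a) = z (p i))} *
        card {b. b < n2 \<and> (\<forall>i<m2. S2 $$ (i, b) = z (p (m1 + i)))}"
      by (rule card_div_mod)
    also have "card {a. a < n1 \<and> (\<forall>i<m1. S1 $$ (i, a) = z (p i))} = c1 (part ?A z)"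
      unfolding c1_def by (intro arg_cong[where f = card]) (auto simp: part_def lt)
    also have "card {b. b < n2 \<and> (\<forall>i<m2. S2 $$ (i, b) = z (p (m1 + i)))} = c2 (part (- ?A) z)"
      unfolding c2_def by (intro arg_cong[where f = card]) (auto simp: part_def lt inj)
    finally show ?thesis .
  qed
  then have f: "factors ?A" unfolding factors_def by blast
  have "p 0 \<in> ?A" "p 0 < m1 + m2" "p m1 \<notin> ?A" "p m1 < m1 + m2" "?A \<subseteq> {..<m1 + m2}"
    using pos by (auto simp: lt inj)
  moreover have "factors ({..<m1 + m2} - ?A)" by (rule factors_compl[OF f])
  moreover have "0 < n1 * n2" "0 < m1 + m2" using pos by auto
  ultimately show thesis
    using that[of ?A] that[of "{..<m1 + m2} - ?A"] f unfolding m n by (cases "0 \<in> ?A") auto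
qed

text \<open>The converse construction: rows are permuted by listing \<open>A\<close> before its
  complement, columns by the permutation of \<open>thin_columns_permute\<close>.\<close>

lemma (in columns) matrix_iso_thin:
  assumes S: "S \<in> carrier_mat m n" and X: "X = mcols S"
    and nv: "no_viol A" and n: "0 < n"
    and N: "n1 * n2 = n" and l1: "length (thinA A n2) = n1" and l2: "length (thinA (- A) n1) = n2"
  defines "LA \<equiv> filter (\<lambda>i. i \<in> A) [0..<m]" and "LB \<equiv> filter (\<lambda>i. i \<notin> A) [0..<m]"
  shows "matrix_iso S (mat (length LA) n1 (\<lambda>(i, j). X (thinA A n2 ! j) (LA ! i)) \<otimes>\<^sub>1
     mat (length LB) n2 (\<lambda>(i, j). X (thinA (- A) n1 ! j) (LB ! i)))"
proof -
  let ?L = "LA @ LB"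
  \<comment> \<open>Continued by the identity from \<open>m\<close> on, as \<open>permutes\<close>
    demands.\<close>
  define p where "p i = (if i < m then ?L ! i else i)" for i
  have len: "length ?L = m"
    using sum_length_filter_compl[of "\<lambda>i. i \<in> A" "[0..<m]"] by (simp add: LA_def LB_def)
  have set: "set ?L = {..<m}" and dist: "distinct ?L" by (auto simp: LA_def LB_def)
  have "bij_betw ((!) ?L) {..<m} {..<m}" by (rule bij_betw_nth) (use len set dist in auto)
  then have "bij_betw p {..<m} {..<m}" by (rule bij_betw_cong[THEN iffD1, rotated]) (simp add: p_def)
  then have p: "p permutes {..<m}" by (rule bij_imp_permutes) (simp add: p_def)
  obtain q where q: "q permutes {..<n}" and
    Xq: "\<And>i j. i < m \<Longrightarrow> j < n \<Longrightarrow>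
       mix A (X (thinA A n2 ! (j div n2))) (X (thinA (- A) n1 ! (j mod n2))) i = X (q j) i"
    using thin_columns_permute[OF nv n N l1 l2] by blast
  have d: "dim_row S = m" "dim_col S = n" using S by auto
  let ?T = "mat (length LA) n1 (\<lambda>(i, j). X (thinA A n2 ! j) (LA ! i)) \<otimes>\<^sub>1
     mat (length LB) n2 (\<lambda>(i, j). X (thinA (- A) n1 ! j) (LB ! i))"
  have "?T = mat m n (\<lambda>(i, j). S $$ (p i, q j))"
  proof (rule eq_matI)
    show "dim_row ?T = dim_row (mat m n (\<lambda>(i, j). S $$ (p i, q j)))" using len by (simp add: one_prod_def)
    show "dim_col ?T = dim_col (mat m n (\<lambda>(i, j). S $$ (p i, q j)))" using N by (simp add: one_prod_def)
    fix i j
    assume "i < dim_row (mat m n (\<lambda>(i, j). S $$ (p i, q j)))" "j < dim_col (mat m n (\<lambda>(i, j). S $$ (p i, q j)))"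
    then have ij: "i < m" "j < n" by auto
    have jd: "j div n2 < n1" "j mod n2 < n2" using ij(2) N by (auto simp: less_mult_imp_div_less intro!: mod_less_divisor gr0I)
    have "p i < m" using permutes_in_image[OF p, of i] ij by simp
    have A: "p i \<in> A \<longleftrightarrow> i < length LA"
    proof (cases "i < length LA")
      case True
      then have "LA ! i \<in> set LA" by (rule nth_mem)
      then show ?thesis using True ij by (auto simp: p_def nth_append LA_def)
    next
      case False
      then have "LB ! (i - length LA) \<in> set LB" using ij len by (intro nth_mem) auto
      then show ?thesis using False ij by (auto simp: p_def nth_append LB_def)
    qed
    have "S $$ (p i, q j) = mix A (X (thinA A n2 ! (j div n2))) (X (thinA (- A) n1 ! (j mod n2))) (p i)"
      using Xq[OF \<open>p i < m\<close> ij(2)] by (simp add: X mcols_def)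
    also have "\<dots> = ?T $$ (i, j)"
      using ij jd len N A by (auto simp: one_prod_def mix_def) (auto simp: p_def nth_append)
    finally show "?T $$ (i, j) = mat m n (\<lambda>(i, j). S $$ (p i, q j)) $$ (i, j)" using ij by simp
  qed
  then show ?thesis unfolding matrix_iso_def d using p q by blast
qed

section \<open>The program\<close>

text \<open>
  Scalars and arrays of the program: \<open>o\<close> holds the offsets \<open>i * n\<close> of the rows of \<open>S\<close> (indices cannot be
  multiplied), \<open>a\<close> the characteristic function of \<open>A\<close>, \<open>(p, q)\<close> the best violating pair of columns found
  so far and \<open>b\<close> the size of its gap; \<open>ra\<close> and \<open>rb\<close> list the rows of the two factors, \<open>ca\<close> and \<open>cb\<close> their
  columns, with lengths in \<open>m1\<close>, \<open>m2\<close>, \<open>ka\<close>, \<open>kb\<close>; \<open>h1\<close> and \<open>h2\<close> are the widths being tried and \<open>g\<close> is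
  their product. A parameter \<open>f\<close> selects the rows in \<open>A\<close> (1) or in its complement (0).
\<close>

definition At :: "nexp \<Rightarrow> nexp \<Rightarrow> rexp" where
  "At i j = RArr ''S'' (NAdd (NArr ''o'' i) j)"

text \<open>One routine, two uses: with \<open>f = 0\<close> the result is the size of the gap, and
  the result 0 means that two columns agree on the selected side.\<close>

definition Mis :: "string \<Rightarrow> nat \<Rightarrow> string \<Rightarrow> string \<Rightarrow> com" where
  "Mis v f p q = Filter ''t'' v ''i'' ''m'' Skip
     (BAnd (NEq (NArr ''a'' (V ''i'')) (NConst f)) (BNot (REq (At (V ''i'') (V p)) (At (V ''i'') (V q)))))"

text \<open>The mixed vector is never stored: a column equals it iff it agrees with \<open>p\<close>
  on \<open>A\<close> and with \<open>q\<close> off \<open>A\<close>.\<close>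

definition Count :: "string \<Rightarrow> string \<Rightarrow> string \<Rightarrow> com" where
  "Count r p q = RCount r ''j'' ''n'' (Seq (Mis ''u'' 1 ''j'' p) (Mis ''w'' 0 ''j'' q))
     (BAnd (NEq (V ''u'') (NConst 0)) (NEq (V ''w'') (NConst 0)))"

abbreviation R :: "string \<Rightarrow> rexp" where "R x \<equiv> RArr x (NConst 0)"

definition Test :: com where
  "Test = Seq (Count ''c1'' ''x'' ''x'') (Seq (Count ''c2'' ''y'' ''y'')
     (Seq (Count ''c3'' ''x'' ''y'') (Seq (Count ''c4'' ''y'' ''x'')
       (Cond (REq (RMul (R ''c1'') (R ''c2'')) (RMul (R ''c3'') (R ''c4''))) Skip
         (Seq (''b'' ::= V ''d'') (Seq (''p'' ::= V ''x'') (''q'' ::= V ''y'')))))))"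

text \<open>If there is no violating pair, \<open>p = q = 0\<close> at the end, and the update in \<open>Grow\<close> has no effect.\<close>

definition Search :: com where
  "Search = Seq (''b'' ::= NAdd (V ''m'') (NConst 1)) (Seq (''p'' ::= NConst 0) (Seq (''q'' ::= NConst 0)
     (For ''x'' ''n'' (For ''y'' ''n''
       (Seq (Mis ''d'' 0 ''x'' ''y'') (Cond (NLess (V ''d'') (V ''b'')) Test Skip))))))"

text \<open>Rows of \<open>A\<close> in which the two columns differ are marked again without
  effect, so the new set is \<open>A\<close> together with the gap.\<close>

definition Grow :: com where
  "Grow = Seq Search (For ''i'' ''m''
     (Cond (REq (At (V ''i'') (V ''p'')) (At (V ''i'') (V ''q''))) Skip
       (NAssign ''a'' (V ''i'') (NConst 1))))"

text \<open>The assignment writes cell 0 of \<open>a\<close>, which puts row 0 into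
  \<open>A\<close>. Every round that is not idle adds a row, so \<open>m\<close> rounds
  suffice.\<close>

definition Closure :: com where
  "Closure = Seq (''a'' ::= NConst 1) (For ''e'' ''m'' Grow)"

definition Rows :: "nat \<Rightarrow> string \<Rightarrow> string \<Rightarrow> com" where
  "Rows f r c = Filter r c ''i'' ''m'' Skip (NEq (NArr ''a'' (V ''i'')) (NConst f))"

text \<open>The counter \<open>r\<close> runs modulo the width in \<open>h\<close>.\<close>

definition Rank :: "nat \<Rightarrow> string \<Rightarrow> com" where
  "Rank f h = Seq (''r'' ::= NConst 0) (For ''l'' ''j'' (Seq (Mis ''u'' f ''l'' ''j'')
     (Cond (NEq (V ''u'') (NConst 0))
       (Seq (''r'' ::= NAdd (V ''r'') (NConst 1)) (Cond (NEq (V ''r'') (V h)) (''r'' ::= NConst 0) Skip))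
       Skip)))"

definition Cols :: "nat \<Rightarrow> string \<Rightarrow> string \<Rightarrow> string \<Rightarrow> com" where
  "Cols f h r c = Filter r c ''j'' ''n'' (Rank f h) (NEq (V ''r'') (NConst 0))"

text \<open>\<open>z\<close> runs through the target in row order, which avoids multiplying
  indices.\<close>

definition Fill :: "string \<Rightarrow> string \<Rightarrow> string \<Rightarrow> string \<Rightarrow> string \<Rightarrow> com" where
  "Fill M r mr c mc = Seq (''z'' ::= NConst 0) (For ''i'' mr (For ''j'' mc
     (Seq (RAssign M (V ''z'') (At (NArr r (V ''i'')) (NArr c (V ''j''))))
       (''z'' ::= NAdd (V ''z'') (NConst 1)))))"

definition Output :: com where
  "Output = Seq (''n1'' ::= V ''ka'') (Seq (''n2'' ::= V ''kb'')
     (Seq (Fill ''S1'' ''ra'' ''m1'' ''ca'' ''ka'')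
     (Seq (Fill ''S2'' ''rb'' ''m2'' ''cb'' ''kb'') (''yes'' ::= NConst 1))))"

definition Attempt :: com where
  "Attempt = Seq (Cols 1 ''h2'' ''ca'' ''ka'') (Seq (Cols 0 ''h1'' ''cb'' ''kb'')
     (Cond (BAnd (NEq (V ''ka'') (V ''h1'')) (BAnd (NEq (V ''kb'') (V ''h2''))
         (BAnd (NEq (V ''g'') (V ''n'')) (NLess (NConst 0) (V ''m2''))))) Output Skip))"

definition Factor :: com where
  "Factor = For ''x'' ''n'' (Seq (''h1'' ::= NAdd (V ''x'') (NConst 1)) (Seq (''g'' ::= NConst 0)
     (For ''y'' ''n'' (Seq (''h2'' ::= NAdd (V ''y'') (NConst 1)) 
       (Seq (''g'' ::= NAdd (V ''g'') (V ''h1'')) Attempt)))))"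

definition Offsets :: com where
  "Offsets = Seq (''z'' ::= NConst 0) (For ''i'' ''m''
     (Seq (NAssign ''o'' (V ''i'') (V ''z'')) (''z'' ::= NAdd (V ''z'') (V ''n''))))"

text \<open>For a matrix without rows or columns \<open>yes\<close> keeps its initial 0, the right
  verdict because both factors must be non-empty.\<close>

definition Algorithm :: com where
  "Algorithm = Cond (BAnd (NLess (NConst 0) (V ''m'')) (NLess (NConst 0) (V ''n'')))
     (Seq Offsets (Seq Closure (Seq (Rows 1 ''ra'' ''m1'') (Seq (Rows 0 ''rb'' ''m2'') Factor)))) Skip"

section \<open>Write sets of the program parts\<close>

lemma nw_simps [simp]:
  "nw (Mis v f p q) = {''t'', v, ''i''}"
  "nw (Count r p q) = {''j'', ''t'', ''u'', ''w'', ''i''}"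
  "nw Test = {''j'', ''t'', ''u'', ''w'', ''i'', ''b'', ''p'', ''q''}"
  "nw Search = {''j'', ''t'', ''u'', ''w'', ''i'', ''b'', ''p'', ''q'', ''x'', ''y'', ''d''}"
  "nw Grow = {''j'', ''t'', ''u'', ''w'', ''i'', ''b'', ''p'', ''q'', ''x'', ''y'', ''d'', ''a''}"
  "nw (Rows f r c) = {r, c, ''i''}"
  "nw (Rank f h) = {''r'', ''l'', ''t'', ''u'', ''i''}"
  "nw (Cols f h r c) = {r, c, ''j'', ''r'', ''l'', ''t'', ''u'', ''i''}"
  "nw (Fill M r mr c mc) = {''z'', ''i'', ''j''}"
  "nw Output = {''n1'', ''n2'', ''z'', ''i'', ''j'', ''yes''}"
  "nw Attempt = {''n1'', ''n2'', ''z'', ''yes'', ''ca'', ''ka'', ''cb'', ''kb'', ''j'', ''r'', ''l'', ''t'', ''u'', ''i''}"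
  by (auto simp: Mis_def Count_def Test_def Search_def Grow_def Rows_def Rank_def Cols_def Fill_def
      Output_def Attempt_def)

lemma rw_simps [simp]:
  "rw (Mis v f p q) = {}"
  "rw (Count r p q) = {r}"
  "rw Test = {''c1'', ''c2'', ''c3'', ''c4''}"
  "rw Search = {''c1'', ''c2'', ''c3'', ''c4''}"
  "rw Grow = {''c1'', ''c2'', ''c3'', ''c4''}"
  "rw (Rows f r c) = {}"
  "rw (Rank f h) = {}"
  "rw (Cols f h r c) = {}"
  "rw (Fill M r mr c mc) = {M}"
  "rw Output = {''S1'', ''S2''}"
  "rw Attempt = {''S1'', ''S2''}"
  by (auto simp: Mis_def Count_def Test_def Search_def Grow_def Rows_def Rank_def Cols_def Fill_def
      Output_def Attempt_def)

section \<open>Contents of the memory\<close>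

definition holds_list :: "state \<Rightarrow> string \<Rightarrow> string \<Rightarrow> nat list \<Rightarrow> bool" where
  "holds_list s r c xs \<longleftrightarrow> nmem s c 0 = length xs \<and> (\<forall>k<length xs. nmem s r k = xs ! k)"

lemma holds_list_frame:
  "\<lbrakk>frame X Y s s'; holds_list s r c xs; r \<notin> X; c \<notin> X\<rbrakk> \<Longrightarrow> holds_list s' r c xs"
  by (simp add: holds_list_def frame_nmem)

definition side :: "nat set \<Rightarrow> nat \<Rightarrow> nat set" where
  "side A f = (if f = 0 then - A else A)"

lemma side_simps [simp]: "side A 0 = - A" "side A (Suc 0) = A"
  by (simp_all add: side_def)

text \<open>\<open>N\<close> is the common iteration bound at which \<open>tb\<close> is
  evaluated.\<close>

locale real_columns = columns m n X for m n :: nat and X :: "nat \<Rightarrow> nat \<Rightarrow> real" +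
  fixes N :: nat
  assumes m_pos: "0 < m" and n_pos: "0 < n" and m_le: "m \<le> N" and n_le: "n \<le> N"
begin

definition loaded :: "state \<Rightarrow> bool" where
  "loaded s \<longleftrightarrow> nmem s ''m'' 0 = m \<and> nmem s ''n'' 0 = n \<and> (\<forall>i<m. nmem s ''o'' i = i * n) \<and>
     (\<forall>i<m. \<forall>j<n. rmem s ''S'' (i * n + j) = X j i)"

definition masked :: "nat set \<Rightarrow> state \<Rightarrow> bool" where
  "masked A s \<longleftrightarrow> (\<forall>i<m. nmem s ''a'' i = (if i \<in> A then 1 else 0))"

lemma loaded_frame:
  "\<lbrakk>frame Z Y s s'; loaded s; ''m'' \<notin> Z; ''n'' \<notin> Z; ''o'' \<notin> Z; ''S'' \<notin> Y\<rbrakk> \<Longrightarrow> loaded s'"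
  by (simp add: loaded_def frame_nmem frame_rmem)

lemma masked_frame: "\<lbrakk>frame Z Y s s'; masked A s; ''a'' \<notin> Z\<rbrakk> \<Longrightarrow> masked A s'"
  by (simp add: masked_def frame_nmem)

lemma rval_At:
  "\<lbrakk>loaded s; nval i s < m; nval j s < n\<rbrakk> \<Longrightarrow> rval (At i j) s = X (nval j s) (nval i s)"
  by (simp add: At_def loaded_def)

definition mis :: "nat set \<Rightarrow> nat \<Rightarrow> nat \<Rightarrow> nat" where
  "mis B x y = card {i. i < m \<and> i \<in> B \<and> X x i \<noteq> X y i}"

lemma mis_eq_0_iff: "mis B x y = 0 \<longleftrightarrow> part B (X x) = part B (X y)"
  by (auto simp: mis_def part_eq_iff)

lemma mis_gap: "mis (- A) x y = card (gap A x y)"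
  by (simp add: mis_def gap_def)

section \<open>Comparing and counting columns\<close>

lemma runs_Mis:
  assumes L: "loaded s" and A: "masked A s" and x: "nmem s p 0 = x" "x < n" and y: "nmem s q 0 = y" "y < n"
    and f: "f = 0 \<or> f = 1" and v: "v \<notin> {''t'', ''i'', ''m'', ''n'', ''o'', ''a'', p, q}"
    and pq: "p \<notin> {''t'', ''i''}" "q \<notin> {''t'', ''i''}"
  shows "runs N (Mis v f p q) s (\<lambda>s'. nmem s' v 0 = mis (side A f) x y)"
  unfolding Mis_def
proof (rule runs_mono[OF runs_Filter[where K = m and P = "\<lambda>i. i \<in> side A f \<and> X x i \<noteq> X y i"]])
  show "nmem s ''m'' 0 = m" using L by (simp add: loaded_def)
  show "m \<le> N" by (rule m_le)
  show "distinct [''t'', v, ''i'', ''m'']" using v by auto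
  fix k s'
  assume k: "k < m" "nmem s' ''i'' 0 = k" and fr: "frame ({''t'', v, ''i''} \<union> nw Skip) (rw Skip) s s'"
  have L': "loaded s'" by (rule loaded_frame[OF fr L]) (use v in auto)
  have "nmem s' ''a'' = nmem s ''a''" "nmem s' p = nmem s p" "nmem s' q = nmem s q"
    using v pq by (auto simp: frame_nmem[OF fr])
  then show "runs N Skip s' (\<lambda>s''. bval (BAnd (NEq (NArr ''a'' (V ''i'')) (NConst f))
       (BNot (REq (At (V ''i'') (V p)) (At (V ''i'') (V q))))) s'' = (k \<in> side A f \<and> X x k \<noteq> X y k))"
    using k A x y f by (intro runs_Skip) (auto simp: rval_At[OF L'] masked_def side_def)
next
  fix s'
  assume "nmem s' v 0 = length (filter (\<lambda>i. i \<in> side A f \<and> X x i \<noteq> X y i) [0..<m]) \<and>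
    (\<forall>k<length (filter (\<lambda>i. i \<in> side A f \<and> X x i \<noteq> X y i) [0..<m]).
        nmem s' ''t'' k = filter (\<lambda>i. i \<in> side A f \<and> X x i \<noteq> X y i) [0..<m] ! k)"
  then show "nmem s' v 0 = mis (side A f) x y" by (simp add: mis_def length_filter_upt)
qed simp_all

lemma runs_Count:
  assumes L: "loaded s" and A: "masked A s" and x: "nmem s p 0 = x" "x < n" and y: "nmem s q 0 = y" "y < n"
    and r: "r \<noteq> ''S''"
    and pq: "p \<notin> {''t'', ''i'', ''j'', ''u'', ''w''}" "q \<notin> {''t'', ''i'', ''j'', ''u'', ''w''}"
  shows "runs N (Count r p q) s (\<lambda>s'. rmem s' r 0 = real (cnt (mix A (X x) (X y))))"
proof -
  let ?P = "\<lambda>j. \<forall>i<m. X j i = mix A (X x) (X y) i"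
  show ?thesis
    unfolding Count_def cnt_def
  proof (rule runs_RCount)
    show "nmem s ''n'' 0 = n" using L by (simp add: loaded_def)
    show "n \<le> N" by (rule n_le)
    fix k s'
    let ?b = "BAnd (NEq (V ''u'') (NConst 0)) (NEq (V ''w'') (NConst 0))"
    assume k: "k < n" "nmem s' ''j'' 0 = k"
      and fr: "frame (insert ''j'' (nw (Seq (Mis ''u'' 1 ''j'' p) (Mis ''w'' 0 ''j'' q))))
        (insert r (rw (Seq (Mis ''u'' 1 ''j'' p) (Mis ''w'' 0 ''j'' q)))) s s'"
    have L': "loaded s'" by (rule loaded_frame[OF fr L]) (use r in auto)
    have A': "masked A s'" by (rule masked_frame[OF fr A]) auto
    have p': "nmem s' p 0 = x" "nmem s' q 0 = y" using pq x y by (simp_all add: frame_nmem[OF fr])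
    show "runs N (Seq (Mis ''u'' 1 ''j'' p) (Mis ''w'' 0 ''j'' q)) s' (\<lambda>s''. bval ?b s'' = ?P k)"
    proof (rule runs_Seq[OF runs_Mis[OF L' A' k(2,1) p'(1) x(2)]])
      fix t
      assume fr2: "frame (nw (Mis ''u'' 1 ''j'' p)) (rw (Mis ''u'' 1 ''j'' p)) s' t"
        and u: "nmem t ''u'' 0 = mis (side A 1) k x"
      have L2: "loaded t" by (rule loaded_frame[OF fr2 L']) auto
      have A2: "masked A t" by (rule masked_frame[OF fr2 A']) auto
      have q2: "nmem t q 0 = y" "nmem t ''j'' 0 = k" using pq p' k by (simp_all add: frame_nmem[OF fr2])
      show "runs N (Mis ''w'' 0 ''j'' q) t (\<lambda>s''. bval ?b s'' = ?P k)"
      proof (rule runs_mono[OF runs_Mis[OF L2 A2 q2(2) k(1) q2(1) y(2)]])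
        fix t'
        assume fr3: "frame (nw (Mis ''w'' 0 ''j'' q)) (rw (Mis ''w'' 0 ''j'' q)) t t'"
          and w: "nmem t' ''w'' 0 = mis (side A 0) k y"
        \<comment> \<open>Both calls share the scratch names \<open>t\<close> and \<open>i\<close>,
          but the first result survives in \<open>u\<close>.\<close>
        have "nmem t' ''u'' = nmem t ''u''" using frame_nmem[OF fr3] by simp
        with u w show "bval ?b t' = ?P k"
          by (auto simp: mis_eq_0_iff part_eq_iff mix_def)
      qed (use pq in auto)
    qed (use pq in auto)
  qed (use r in auto)
qed

text \<open>Makes \<open>Count\<close> with one column given twice return the multiplicity of that
  column.\<close>

lemma mix_same [simp]: "mix A z z = z"
  by (auto simp: mix_def)

section \<open>Searching for a minimal violating pair\<close>

lemma runs_Test: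
  assumes L: "loaded s" and A: "masked A s" and x: "nmem s ''x'' 0 = x" "x < n" and y: "nmem s ''y'' 0 = y" "y < n"
  shows "runs N Test s (\<lambda>s'. (nmem s' ''b'' 0, nmem s' ''p'' 0, nmem s' ''q'' 0) =
    (if viol A x y then (nmem s ''d'' 0, x, y) else (nmem s ''b'' 0, nmem s ''p'' 0, nmem s ''q'' 0)))"
    (is "runs N Test s ?Q")
proof -
  \<comment> \<open>The natural arrays written by any of the four calls of \<open>Count\<close>;
    \<open>st\<close> carries all other facts across them.\<close>
  let ?Z = "{''j'', ''t'', ''u'', ''w'', ''i''}"
  have st: "loaded s'" "masked A s'" "nmem s' ''x'' 0 = x" "nmem s' ''y'' 0 = y"
    "nmem s' ''b'' = nmem s ''b''" "nmem s' ''p'' = nmem s ''p''" "nmem s' ''q'' = nmem s ''q''"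
    "nmem s' ''d'' = nmem s ''d''"
    if "frame ?Z Y s s'" "''S'' \<notin> Y" for Y s'
    using loaded_frame[OF that(1) L] masked_frame[OF that(1) A] that(2) x y
    by (simp_all add: frame_nmem[OF that(1)])
  have trans: "frame Z (Y \<union> Y') s s''" if "frame Z Y s s'" "frame Z Y' s' s''" for Z Y Y' s' s''
    using that by (auto simp: frame_def)
  show ?thesis
    unfolding Test_def
  proof (rule runs_Seq[OF runs_Count[OF L A x x]]; (simp; fail)?)
    fix s1
    assume f1: "frame (nw (Count ''c1'' ''x'' ''x'')) (rw (Count ''c1'' ''x'' ''x'')) s s1"
      and c1: "rmem s1 ''c1'' 0 = real (cnt (mix A (X x) (X x)))"
    note f1 = f1[simplified]
    note s1 = st[OF f1, simplified]
    show "runs N (Seq (Count ''c2'' ''y'' ''y'')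
     (Seq (Count ''c3'' ''x'' ''y'') (Seq (Count ''c4'' ''y'' ''x'')
       (Cond (REq (RMul (R ''c1'') (R ''c2'')) (RMul (R ''c3'') (R ''c4''))) Skip
         (Seq (''b'' ::= V ''d'') (Seq (''p'' ::= V ''x'') (''q'' ::= V ''y''))))))) s1 ?Q"
    proof (rule runs_Seq[OF runs_Count[OF s1(1,2) s1(4) y(2) s1(4) y(2)]]; (simp; fail)?)
      fix s2
      assume f2: "frame (nw (Count ''c2'' ''y'' ''y'')) (rw (Count ''c2'' ''y'' ''y'')) s1 s2"
        and c2: "rmem s2 ''c2'' 0 = real (cnt (mix A (X y) (X y)))"
      note f2 = f2[simplified]
      note s2 = st[OF trans[OF f1 f2], simplified]
      show "runs N (Seq (Count ''c3'' ''x'' ''y'') (Seq (Count ''c4'' ''y'' ''x'')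
       (Cond (REq (RMul (R ''c1'') (R ''c2'')) (RMul (R ''c3'') (R ''c4''))) Skip
         (Seq (''b'' ::= V ''d'') (Seq (''p'' ::= V ''x'') (''q'' ::= V ''y'')))))) s2 ?Q"
      proof (rule runs_Seq[OF runs_Count[OF s2(1,2) s2(3) x(2) s2(4) y(2)]]; (simp; fail)?)
        fix s3
        assume f3: "frame (nw (Count ''c3'' ''x'' ''y'')) (rw (Count ''c3'' ''x'' ''y'')) s2 s3"
          and c3: "rmem s3 ''c3'' 0 = real (cnt (mix A (X x) (X y)))"
        note f3 = f3[simplified]
        note s3 = st[OF trans[OF trans[OF f1 f2] f3], simplified]
        show "runs N (Seq (Count ''c4'' ''y'' ''x'')
          (Cond (REq (RMul (R ''c1'') (R ''c2'')) (RMul (R ''c3'') (R ''c4''))) Skip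
          (Seq (''b'' ::= V ''d'') (Seq (''p'' ::= V ''x'') (''q'' ::= V ''y''))))) s3 ?Q"
        proof (rule runs_Seq[OF runs_Count[OF s3(1,2) s3(4) y(2) s3(3) x(2)]]; (simp; fail)?)
          fix s4
          assume f4: "frame (nw (Count ''c4'' ''y'' ''x'')) (rw (Count ''c4'' ''y'' ''x'')) s3 s4"
            and c4: "rmem s4 ''c4'' 0 = real (cnt (mix A (X y) (X x)))"
          note f4 = f4[simplified]
          note s4 = st[OF trans[OF trans[OF trans[OF f1 f2] f3] f4], simplified]
          have c: "rmem s4 ''c1'' = rmem s1 ''c1''" "rmem s4 ''c2'' = rmem s2 ''c2''" "rmem s4 ''c3'' = rmem s3 ''c3''"
            by (simp_all add: frame_rmem[OF f2] frame_rmem[OF f3] frame_rmem[OF f4])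
          \<comment> \<open>The counts are naturals embedded in the reals, so the exact real
            comparison decides the identity between naturals.\<close>
          have "bval (REq (RMul (R ''c1'') (R ''c2'')) (RMul (R ''c3'') (R ''c4''))) s4 \<longleftrightarrow> \<not> viol A x y"
            using c1 c2 c3 c4 by (simp add: c viol_def flip: of_nat_mult)
          then show "runs N (Cond (REq (RMul (R ''c1'') (R ''c2'')) (RMul (R ''c3'') (R ''c4''))) Skip
              (Seq (''b'' ::= V ''d'') (Seq (''p'' ::= V ''x'') (''q'' ::= V ''y'')))) s4 ?Q"
            by (intro runs_Cond runs_Skip runs_Seq_wp runs_NAssign) (simp_all add: s4)
        qed
      qed
    qed
  qed
qed

text \<open>\<open>W\<close> collects the pairs examined so far. The sentinel \<open>m + 1\<close>
  exceeds the size of every gap, so the first violation is always accepted.\<close>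

definition optimal :: "nat set \<Rightarrow> (nat \<times> nat) set \<Rightarrow> nat \<Rightarrow> nat \<Rightarrow> nat \<Rightarrow> bool" where
  "optimal A W b p q \<longleftrightarrow> p < n \<and> q < n \<and>
     (b = m + 1 \<and> p = 0 \<and> q = 0 \<and> (\<forall>(x, y)\<in>W. \<not> viol A x y) \<or>
      viol A p q \<and> b = card (gap A p q) \<and> (\<forall>(x, y)\<in>W. viol A x y \<longrightarrow> b \<le> card (gap A x y)))"

lemma optimal_update:
  assumes "optimal A W b p q" "x < n" "y < n" "viol A x y" "card (gap A x y) < b"
  shows "optimal A (insert (x, y) W) (card (gap A x y)) x y"
  using assms unfolding optimal_def by fastforce

text \<open>While \<open>b\<close> is the sentinel, the assumption can hold only for a pair that is
  no violation, because a gap has at most \<open>m\<close> rows.\<close>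

lemma optimal_keep:
  assumes "optimal A W b p q" "viol A x y \<Longrightarrow> b \<le> card (gap A x y)"
  shows "optimal A (insert (x, y) W) b p q"
  using assms card_gap_le[of A x y] unfolding optimal_def by fastforce

abbreviation best :: "nat set \<Rightarrow> (nat \<times> nat) set \<Rightarrow> state \<Rightarrow> bool" where
  "best A W s \<equiv> optimal A W (nmem s ''b'' 0) (nmem s ''p'' 0) (nmem s ''q'' 0)"

lemma runs_Search_step:
  assumes L: "loaded s" and A: "masked A s" and x: "nmem s ''x'' 0 = x" "x < n" and y: "nmem s ''y'' 0 = y" "y < n"
    and W: "best A W s"
  shows "runs N (Seq (Mis ''d'' 0 ''x'' ''y'') (Cond (NLess (V ''d'') (V ''b'')) Test Skip)) s (best A (insert (x, y) W))"
proof (rule runs_Seq[OF runs_Mis[OF L A x y]]; (simp; fail)?)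
  fix s'
  assume fr: "frame (nw (Mis ''d'' 0 ''x'' ''y'')) (rw (Mis ''d'' 0 ''x'' ''y'')) s s'"
    and "nmem s' ''d'' 0 = mis (side A 0) x y"
  then have d: "nmem s' ''d'' 0 = card (gap A x y)" by (simp add: mis_gap)
  note fr = fr[simplified]
  have L': "loaded s'" by (rule loaded_frame[OF fr L]) auto
  have A': "masked A s'" by (rule masked_frame[OF fr A]) auto
  have x': "nmem s' ''x'' 0 = x" "nmem s' ''y'' 0 = y" using x y by (simp_all add: frame_nmem[OF fr])
  have W': "best A W s'" using W by (simp add: frame_nmem[OF fr])
  show "runs N (Cond (NLess (V ''d'') (V ''b'')) Test Skip) s' (best A (insert (x, y) W))"
  proof (rule runs_Cond)
    assume "bval (NLess (V ''d'') (V ''b'')) s'"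
    then have less: "card (gap A x y) < nmem s' ''b'' 0" by (simp add: d)
    show "runs N Test s' (best A (insert (x, y) W))"
    proof (rule runs_mono[OF runs_Test[OF L' A' x'(1) x(2) x'(2) y(2)]])
      fix s'' :: state
      assume t: "(nmem s'' ''b'' 0, nmem s'' ''p'' 0, nmem s'' ''q'' 0) =
        (if viol A x y then (nmem s' ''d'' 0, x, y) else (nmem s' ''b'' 0, nmem s' ''p'' 0, nmem s' ''q'' 0))"
      show "best A (insert (x, y) W) s''"
      proof (cases "viol A x y")
        case True
        then show ?thesis using t d optimal_update[OF W' x(2) y(2) True less] by simp
      next
        case False
        then show ?thesis using t optimal_keep[OF W', of x y] by simp
      qed
    qed
  next
    assume "\<not> bval (NLess (V ''d'') (V ''b'')) s'"
    then have "nmem s' ''b'' 0 \<le> card (gap A x y)" by (simp add: d)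
    then show "runs N Skip s' (best A (insert (x, y) W))"
      by (intro runs_Skip optimal_keep W')
  qed
qed

lemma loaded_upd [simp]:
  "v \<notin> {''m'', ''n'', ''o''} \<Longrightarrow> loaded (nupd v i e s) = loaded s"
  "v \<noteq> ''S'' \<Longrightarrow> loaded (rupd v i x s) = loaded s"
  by (simp_all add: loaded_def)

lemma masked_upd [simp]:
  "v \<noteq> ''a'' \<Longrightarrow> masked A (nupd v i e s) = masked A s"
  "masked A (rupd v i x s) = masked A s"
  by (simp_all add: masked_def)

lemma runs_Search:
  assumes L: "loaded s" and A: "masked A s"
  shows "runs N Search s (best A ({..<n} \<times> {..<n}))"
proof -
  let ?c = "Seq (Mis ''d'' 0 ''x'' ''y'') (Cond (NLess (V ''d'') (V ''b'')) Test Skip)"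
  let ?s = "nupd ''q'' 0 0 (nupd ''p'' 0 0 (nupd ''b'' 0 (m + 1) s))"
  have Ls: "loaded ?s" and As: "masked A ?s" using L A by simp_all
  have inner: "runs N (For ''y'' ''n'' ?c) s' (\<lambda>s''. best A ({..<Suc k} \<times> {..<n}) s'')"
    if L': "loaded s'" and A': "masked A s'" and k: "k < n" "nmem s' ''x'' 0 = k"
      and I: "best A ({..<k} \<times> {..<n}) s'" for k s'
  proof (rule runs_For[where K = n and I = "\<lambda>l t. best A ({..<k} \<times> {..<n} \<union> {k} \<times> {..<l}) t"])
    show "nmem s' ''n'' 0 = n" using L' by (simp add: loaded_def)
    show "best A ({..<k} \<times> {..<n} \<union> {k} \<times> {..<0}) (nupd ''y'' 0 0 s')" using I by simp
    fix l t
    assume l: "l < n" "nmem t ''y'' 0 = l" and fr: "frame (insert ''y'' (nw ?c)) (rw ?c) s' t"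
      and J: "best A ({..<k} \<times> {..<n} \<union> {k} \<times> {..<l}) t"
    note fr = fr[simplified]
    have Lt: "loaded t" by (rule loaded_frame[OF fr L']) simp_all
    have Mt: "masked A t" by (rule masked_frame[OF fr A']) simp
    have xt: "nmem t ''x'' 0 = k" using k by (simp add: frame_nmem[OF fr])
    have e: "insert (k, l) ({..<k} \<times> {..<n} \<union> {k} \<times> {..<l}) = {..<k} \<times> {..<n} \<union> {k} \<times> {..<Suc l}"
      by auto
    show "runs N ?c t (\<lambda>s''. best A ({..<k} \<times> {..<n} \<union> {k} \<times> {..<Suc l}) (nupd ''y'' 0 (Suc l) s''))"
      by (rule runs_mono[OF runs_Search_step[OF Lt Mt xt k(1) l(2,1) J]]) (simp add: e)
  next
    fix t :: state assume "best A ({..<k} \<times> {..<n} \<union> {k} \<times> {..<n}) t"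
    moreover have "{..<k} \<times> {..<n} \<union> {k} \<times> {..<n} = {..<Suc k} \<times> {..<n}" by auto
    ultimately show "best A ({..<Suc k} \<times> {..<n}) t" by simp
  qed (use n_le in simp_all)
  have "runs N (For ''x'' ''n'' (For ''y'' ''n'' ?c)) ?s (best A ({..<n} \<times> {..<n}))"
  proof (rule runs_For[where K = n and I = "\<lambda>k t. best A ({..<k} \<times> {..<n}) t"])
    show "nmem ?s ''n'' 0 = n" using L by (simp add: loaded_def)
    show "best A ({..<0} \<times> {..<n}) (nupd ''x'' 0 0 ?s)" using n_pos by (simp add: optimal_def)
    fix k t
    assume k: "k < n" "nmem t ''x'' 0 = k" and fr: "frame (insert ''x'' (nw (For ''y'' ''n'' ?c))) (rw (For ''y'' ''n'' ?c)) ?s t"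
      and J: "best A ({..<k} \<times> {..<n}) t"
    have Lt: "loaded t" by (rule loaded_frame[OF fr Ls]) simp_all
    have Mt: "masked A t" by (rule masked_frame[OF fr As]) simp
    show "runs N (For ''y'' ''n'' ?c) t (\<lambda>s''. best A ({..<Suc k} \<times> {..<n}) (nupd ''x'' 0 (Suc k) s''))"
      by (rule runs_mono[OF inner[OF Lt Mt k J]]) simp
  qed (use n_le in simp_all)
  moreover have "nmem s ''m'' 0 = m" using L by (simp add: loaded_def)
  ultimately show ?thesis unfolding Search_def
    by (intro runs_Seq_wp runs_NAssign) simp
qed

section \<open>Growing the row set\<close>

text \<open>Strict growth bounds the number of rounds; the last clause keeps the set inside every
  factorising block that contained it before.\<close>

definition grows :: "nat set \<Rightarrow> nat set \<Rightarrow> bool" where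
  "grows A B \<longleftrightarrow> A \<subseteq> B \<and> B \<subseteq> {..<m} \<and> (if no_viol A then B = A else card A < card B) \<and>
     (\<forall>A'. factors A' \<and> A \<subseteq> A' \<longrightarrow> B \<subseteq> A')"

text \<open>Without a violation \<open>p = q = 0\<close> and the gap is empty. Otherwise the pair is
  minimal among all pairs, and \<open>minimal_violation\<close> applies.\<close>

lemma optimal_grows:
  assumes A: "A \<subseteq> {..<m}" and o: "optimal A ({..<n} \<times> {..<n}) b p q"
  shows "grows A (A \<union> gap A p q)"
proof (cases "viol A p q")
  case False
  then have "no_viol A" "p = 0" "q = 0" using o by (auto simp: optimal_def no_viol_def)
  moreover from this have "gap A p q = {}" by (simp add: gap_def)
  ultimately show ?thesis using A by (simp add: grows_def)
next
  case True
  have g: "gap A p q \<noteq> {}" by (rule viol_gap[OF True])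
  have pq: "p < n" "q < n" using o by (simp_all add: optimal_def)
  have min: "card (gap A p q) \<le> card (gap A x y)" if "x < n" "y < n" "viol A x y" for x y
    using o that True by (auto simp: optimal_def)
  have "finite A" using A finite_subset by blast
  then have "card A < card (A \<union> gap A p q)" using g by (intro psubset_card_mono) (auto simp: gap_def)
  moreover have "\<not> no_viol A" using True pq by (auto simp: no_viol_def)
  moreover have "A \<union> gap A p q \<subseteq> {..<m}" using A by (auto simp: gap_def)
  moreover have "A \<union> gap A p q \<subseteq> A'" if "factors A'" "A \<subseteq> A'" for A'
    using minimal_violation[OF that pq True min] that by blast
  ultimately show ?thesis by (auto simp: grows_def)
qed

lemma runs_Grow:
  assumes L: "loaded s" and A: "masked A s" and Am: "A \<subseteq> {..<m}"
  shows "runs N Grow s (\<lambda>s'. \<exists>B. grows A B \<and> masked B s')"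
  unfolding Grow_def
proof (rule runs_Seq[OF runs_Search[OF L A]])
  let ?b = "REq (At (V ''i'') (V ''p'')) (At (V ''i'') (V ''q''))"
  let ?c = "Cond ?b Skip (NAssign ''a'' (V ''i'') (NConst 1))"
  fix s'
  assume fr: "frame (nw Search) (rw Search) s s'" and o: "best A ({..<n} \<times> {..<n}) s'"
  have L': "loaded s'" by (rule loaded_frame[OF fr L]) simp_all
  have A': "masked A s'" by (rule masked_frame[OF fr A]) simp
  define p q where pq: "p = nmem s' ''p'' 0" "q = nmem s' ''q'' 0"
  have lt: "p < n" "q < n" using o by (simp_all add: pq optimal_def)
  let ?I = "\<lambda>k t. \<forall>i<m. nmem t ''a'' i = (if i \<in> A \<or> i < k \<and> X p i \<noteq> X q i then 1 else 0)"
  show "runs N (For ''i'' ''m'' ?c) s' (\<lambda>s'. \<exists>B. grows A B \<and> masked B s')"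
  proof (rule runs_For[where K = m and I = ?I])
    show "nmem s' ''m'' 0 = m" using L' by (simp add: loaded_def)
    show "?I 0 (nupd ''i'' 0 0 s')" using A' by (simp add: masked_def)
    fix k t
    assume k: "k < m" "nmem t ''i'' 0 = k" and fr: "frame (insert ''i'' (nw ?c)) (rw ?c) s' t" and I: "?I k t"
    have Lt: "loaded t" by (rule loaded_frame[OF fr L']) simp_all
    have pqt: "nmem t ''p'' 0 = p" "nmem t ''q'' 0 = q" by (simp_all add: frame_nmem[OF fr] pq)
    have b: "bval ?b t \<longleftrightarrow> X p k = X q k" using lt k by (simp add: rval_At[OF Lt] pqt)
    show "runs N ?c t (\<lambda>s''. ?I (Suc k) (nupd ''i'' 0 (Suc k) s''))"
      by (rule runs_Cond; (rule runs_Skip runs_NAssign)) (use b I k in \<open>auto simp: less_Suc_eq\<close>)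
  next
    fix t :: state assume "?I m t"
    then have "masked (A \<union> gap A p q) t" by (auto simp: masked_def gap_def)
    then show "\<exists>B. grows A B \<and> masked B t" using optimal_grows[OF Am o] pq by blast
  qed (use m_le in simp_all)
qed

text \<open>If some proper subset of the rows contains row 0 and factorises, a stable set is proper
  as well. So the test for a non-empty complement is decisive.\<close>

definition stable :: "nat set \<Rightarrow> bool" where
  "stable A \<longleftrightarrow> 0 \<in> A \<and> A \<subseteq> {..<m} \<and> no_viol A \<and> (\<forall>A'. factors A' \<and> 0 \<in> A' \<longrightarrow> A \<subseteq> A')"

lemma runs_Closure:
  assumes L: "loaded s" and a: "\<And>i. nmem s ''a'' i = 0"
  shows "runs N Closure s (\<lambda>s'. \<exists>A. stable A \<and> masked A s')"
proof -
  let ?s = "nupd ''a'' 0 1 s"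
  \<comment> \<open>After \<open>k\<close> rounds the process has stopped or \<open>A\<close> has
    more than \<open>k\<close> rows; for \<open>k = m\<close> the second alternative is
    impossible.\<close>
  let ?I = "\<lambda>k t. \<exists>A. 0 \<in> A \<and> A \<subseteq> {..<m} \<and> (no_viol A \<or> k < card A) \<and>
      (\<forall>A'. factors A' \<and> 0 \<in> A' \<longrightarrow> A \<subseteq> A') \<and> masked A t"
  have "runs N (For ''e'' ''m'' Grow) ?s (\<lambda>s'. \<exists>A. stable A \<and> masked A s')"
  proof (rule runs_For[where K = m and I = ?I])
    show "nmem ?s ''m'' 0 = m" using L by (simp add: loaded_def)
    show "?I 0 (nupd ''e'' 0 0 ?s)" using m_pos a by (intro exI[of _ "{0}"]) (auto simp: masked_def)
    fix k t
    assume k: "k < m" and fr: "frame (insert ''e'' (nw Grow)) (rw Grow) ?s t" and "?I k t"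
    then obtain A where A: "0 \<in> A" "A \<subseteq> {..<m}" "no_viol A \<or> k < card A"
      "\<forall>A'. factors A' \<and> 0 \<in> A' \<longrightarrow> A \<subseteq> A'" "masked A t" by blast
    have Lt: "loaded t" by (rule loaded_frame[OF fr]) (use L in simp_all)
    show "runs N Grow t (\<lambda>s''. ?I (Suc k) (nupd ''e'' 0 (Suc k) s''))"
    proof (rule runs_mono[OF runs_Grow[OF Lt A(5,2)]])
      fix s'' :: state assume "\<exists>B. grows A B \<and> masked B s''"
      then obtain B where B: "grows A B" "masked B s''" by blast
      have "no_viol B \<or> Suc k < card B" using A(3) B(1) unfolding grows_def by (auto split: if_splits)
      moreover have "0 \<in> B" "B \<subseteq> {..<m}" "\<forall>A'. factors A' \<and> 0 \<in> A' \<longrightarrow> B \<subseteq> A'"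
        using A B(1) unfolding grows_def by blast+
      ultimately show "?I (Suc k) (nupd ''e'' 0 (Suc k) s'')" using B(2) by (intro exI[of _ B]) simp
    qed
  next
    fix t :: state assume "?I m t"
    then obtain A where A: "0 \<in> A" "A \<subseteq> {..<m}" "no_viol A \<or> m < card A"
      "\<forall>A'. factors A' \<and> 0 \<in> A' \<longrightarrow> A \<subseteq> A'" "masked A t" by blast
    have "card A \<le> m" using card_mono[OF _ A(2)] by simp
    then show "\<exists>A. stable A \<and> masked A t" using A by (auto simp: stable_def)
  qed (use m_le in simp_all)
  then show ?thesis unfolding Closure_def by (intro runs_Seq_wp runs_NAssign) simp
qed

section \<open>Row and column lists of the factors\<close>

lemma runs_Rows:
  assumes L: "loaded s" and A: "masked A s" and f: "f = 0 \<or> f = 1"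
    and names: "distinct [r, c, ''i'', ''m'']" "r \<noteq> ''a''" "c \<noteq> ''a''"
  shows "runs N (Rows f r c) s (\<lambda>s'. holds_list s' r c (filter (\<lambda>i. i \<in> side A f) [0..<m]))"
  unfolding Rows_def holds_list_def
proof (rule runs_Filter)
  show "nmem s ''m'' 0 = m" using L by (simp add: loaded_def)
  fix k s'
  assume k: "k < m" "nmem s' ''i'' 0 = k" and fr: "frame ({r, c, ''i''} \<union> nw Skip) (rw Skip) s s'"
  have "masked A s'" by (rule masked_frame[OF fr A]) (use names in auto)
  then show "runs N Skip s' (\<lambda>s''. bval (NEq (NArr ''a'' (V ''i'')) (NConst f)) s'' = (k \<in> side A f))"
    using k f by (intro runs_Skip) (auto simp: masked_def side_def)
qed (use names m_le in simp_all)

lemma runs_Rank: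
  assumes L: "loaded s" and A: "masked A s" and f: "f = 0 \<or> f = 1"
    and j: "nmem s ''j'' 0 = j" "j < n" and d: "nmem s h 0 = d" "0 < d"
    and h: "h \<notin> {''r'', ''l'', ''t'', ''u'', ''i''}"
  shows "runs N (Rank f h) s (\<lambda>s'. nmem s' ''r'' 0 = rank (\<lambda>j. part (side A f) (X j)) j mod d)"
proof -
  let ?f = "\<lambda>j. part (side A f) (X j)"
  let ?b = "NEq (V ''u'') (NConst 0)"
  let ?d = "Seq (''r'' ::= NAdd (V ''r'') (NConst 1)) (Cond (NEq (V ''r'') (V h)) (''r'' ::= NConst 0) Skip)"
  let ?c = "Seq (Mis ''u'' f ''l'' ''j'') (Cond ?b ?d Skip)"
  let ?s = "nupd ''r'' 0 0 s"
  let ?I = "\<lambda>k t. nmem t ''r'' 0 = card {l. l < k \<and> ?f l = ?f j} mod d"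
  have "runs N (For ''l'' ''j'' ?c) ?s (\<lambda>s'. nmem s' ''r'' 0 = rank ?f j mod d)"
  \<comment> \<open>The bound of this loop is the column index itself, so exactly the earlier
    columns are compared.\<close>
  proof (rule runs_For[where K = j and I = ?I])
    show "?I 0 (nupd ''l'' 0 0 ?s)" by simp
    fix k t
    assume k: "k < j" "nmem t ''l'' 0 = k" and fr: "frame (insert ''l'' (nw ?c)) (rw ?c) ?s t" and I: "?I k t"
    have Lt: "loaded t" by (rule loaded_frame[OF fr]) (use L in simp_all)
    have Mt: "masked A t" by (rule masked_frame[OF fr]) (use A in simp_all)
    have ht: "nmem t ''j'' 0 = j" "nmem t h 0 = d" using h j d by (auto simp: frame_nmem[OF fr])
    have hr: "''r'' \<noteq> h" using h by auto
    have kn: "k < n" using k j by simp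
    show "runs N ?c t (\<lambda>s''. ?I (Suc k) (nupd ''l'' 0 (Suc k) s''))"
    proof (rule runs_Seq[OF runs_Mis[OF Lt Mt k(2) kn ht(1) j(2) f]])
      fix t'
      assume fr': "frame (nw (Mis ''u'' f ''l'' ''j'')) (rw (Mis ''u'' f ''l'' ''j'')) t t'"
        and u: "nmem t' ''u'' 0 = mis (side A f) k j"
      have r: "nmem t' ''r'' 0 = card {l. l < k \<and> ?f l = ?f j} mod d" using I by (simp add: frame_nmem[OF fr'])
      have h': "nmem t' h 0 = d" using ht h by (simp add: frame_nmem[OF fr'])
      have S: "card {l. l < Suc k \<and> ?f l = ?f j} =
          card {l. l < k \<and> ?f l = ?f j} + (if ?f k = ?f j then 1 else 0)"
        by (rule card_less_Suc_conj)
      have b: "bval ?b t' \<longleftrightarrow> ?f k = ?f j" by (simp add: u mis_eq_0_iff)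
      show "runs N (Cond ?b ?d Skip) t' (\<lambda>s''. ?I (Suc k) (nupd ''l'' 0 (Suc k) s''))"
      proof (rule runs_Cond)
        assume "bval ?b t'"
        then have S': "card {l. l < Suc k \<and> ?f l = ?f j} = Suc (card {l. l < k \<and> ?f l = ?f j})"
          using b S by simp
        show "runs N ?d t' (\<lambda>s''. ?I (Suc k) (nupd ''l'' 0 (Suc k) s''))"
          \<comment> \<open>Resetting \<open>r\<close> when it reaches \<open>d\<close> is the case
            distinction of \<open>mod_Suc\<close>.\<close>
          unfolding S' using hr
          by (intro runs_Seq_wp runs_NAssign runs_Cond runs_Skip) (simp_all add: r h' mod_Suc)
      next
        assume "\<not> bval ?b t'"
        then show "runs N Skip t' (\<lambda>s''. ?I (Suc k) (nupd ''l'' 0 (Suc k) s''))"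
          using b r unfolding S by (intro runs_Skip) simp
      qed
    qed simp_all
  next
    fix t :: state assume "?I j t"
    then show "nmem t ''r'' 0 = rank ?f j mod d" by (simp add: rank_def)
  qed (use j n_le h in auto)
  then show ?thesis unfolding Rank_def by (intro runs_Seq_wp runs_NAssign) simp
qed

lemma runs_Cols:
  assumes L: "loaded s" and A: "masked A s" and f: "f = 0 \<or> f = 1"
    and d: "nmem s h 0 = d" "0 < d"
    and h: "h \<notin> {''r'', ''l'', ''t'', ''u'', ''i'', ''j'', r, c}"
    and names: "r \<notin> {c, ''m'', ''n'', ''o'', ''a'', ''j'', ''r'', ''l'', ''t'', ''u'', ''i''}"
      "c \<notin> {''m'', ''n'', ''o'', ''a'', ''j'', ''r'', ''l'', ''t'', ''u'', ''i''}"
  shows "runs N (Cols f h r c) s (\<lambda>s'. holds_list s' r c (thinA (side A f) d))"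
  unfolding Cols_def holds_list_def thin_def
proof (rule runs_Filter)
  show "nmem s ''n'' 0 = n" using L by (simp add: loaded_def)
  fix k s'
  assume k: "k < n" "nmem s' ''j'' 0 = k"
    and fr: "frame ({r, c, ''j''} \<union> nw (Rank f h)) (rw (Rank f h)) s s'"
  have L': "loaded s'" by (rule loaded_frame[OF fr L]) (use names in auto)
  have A': "masked A s'" by (rule masked_frame[OF fr A]) (use names in auto)
  have "nmem s' h 0 = d" using d h by (simp add: frame_nmem[OF fr])
  then show "runs N (Rank f h) s' (\<lambda>s''. bval (NEq (V ''r'') (NConst 0)) s'' =
      (rank (\<lambda>j. part (side A f) (X j)) k mod d = 0))"
    by (intro runs_mono[OF runs_Rank[OF L' A' f k(2,1) _ d(2)]]) (use h in simp_all)
qed (use names n_le in simp_all)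

section \<open>Writing the two factors\<close>

lemma runs_Fill:
  assumes L: "loaded s" and xs: "holds_list s r mr xs" "length xs \<le> N" "set xs \<subseteq> {..<m}"
    and ys: "holds_list s c mc ys" "length ys \<le> N" "set ys \<subseteq> {..<n}"
    and names: "M \<noteq> ''S''" "{r, mr, c, mc} \<inter> {''z'', ''i'', ''j''} = {}"
  shows "runs N (Fill M r mr c mc) s (\<lambda>s'. \<forall>i<length xs. \<forall>j<length ys.
    rmem s' M (i * length ys + j) = X (ys ! j) (xs ! i))"
proof -
  let ?c = "Seq (RAssign M (V ''z'') (At (NArr r (V ''i'')) (NArr c (V ''j''))))
       (''z'' ::= NAdd (V ''z'') (NConst 1))"
  let ?w = "length ys"
  let ?s = "nupd ''z'' 0 0 s"
  \<comment> \<open>The first \<open>e\<close> cells are described through \<open>div\<close> and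
    \<open>mod\<close>, so one formula serves as invariant of both loops.\<close>
  let ?D = "\<lambda>e t. nmem t ''z'' 0 = e \<and> (\<forall>e'<e. rmem t M e' = X (ys ! (e' mod ?w)) (xs ! (e' div ?w)))"
  have inner: "runs N (For ''j'' mc ?c) s' (?D (Suc k * ?w))"
    if fr: "frame {''z'', ''i'', ''j''} {M} s s'" and k: "k < length xs" "nmem s' ''i'' 0 = k"
      and I: "?D (k * ?w) s'" for k s'
  proof (rule runs_For[where K = ?w and I = "\<lambda>l. ?D (k * ?w + l)"])
    have l': "holds_list s' c mc ys"
      by (rule holds_list_frame[OF fr ys(1)]) (use names in auto)
    then show "nmem s' mc 0 = ?w" by (simp add: holds_list_def)
    show "?D (k * ?w + 0) (nupd ''j'' 0 0 s')" using I by simp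
    fix l t
    assume l: "l < ?w" "nmem t ''j'' 0 = l" and fr1: "frame (insert ''j'' (nw ?c)) (rw ?c) s' t"
      and J: "?D (k * ?w + l) t"
    have fr2: "frame {''z'', ''i'', ''j''} {M} s t" using fr fr1 by (auto simp: frame_def)
    have Lt: "loaded t" by (rule loaded_frame[OF fr2 L]) (use names in simp_all)
    have "holds_list t r mr xs" "holds_list t c mc ys"
      by (rule holds_list_frame[OF fr2 xs(1)] holds_list_frame[OF fr2 ys(1)]; (use names in auto))+
    moreover have i: "nmem t ''i'' 0 = k" using k by (simp add: frame_nmem[OF fr1])
    moreover have "xs ! k < m" "ys ! l < n" using xs(3) ys(3) k l nth_mem by fastforce+
    ultimately have v: "rval (At (NArr r (V ''i'')) (NArr c (V ''j''))) t = X (ys ! l) (xs ! k)"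
      using k l by (subst rval_At[OF Lt]) (simp_all add: holds_list_def)
    have dm: "(k * ?w + l) mod ?w = l" "(k * ?w + l) div ?w = k"
      using l gr_implies_not0[OF l(1)] by simp_all
    show "runs N ?c t (\<lambda>s''. ?D (k * ?w + Suc l) (nupd ''j'' 0 (Suc l) s''))"
      using J dm by (intro runs_Seq_wp runs_RAssign runs_NAssign) (simp add: v less_Suc_eq del: mod_mult_self3 div_mult_self3)
  qed (use names ys(2) in \<open>auto simp: add.commute\<close>)
  have "runs N (For ''i'' mr (For ''j'' mc ?c)) ?s (?D (length xs * ?w))"
  proof (rule runs_For[where K = "length xs" and I = "\<lambda>k. ?D (k * ?w)"])
    show "nmem ?s mr 0 = length xs" using xs(1) names by (simp add: holds_list_def)
    show "?D (0 * ?w) (nupd ''i'' 0 0 ?s)" by simp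
    fix k t
    assume k: "k < length xs" "nmem t ''i'' 0 = k"
      and fr: "frame (insert ''i'' (nw (For ''j'' mc ?c))) (rw (For ''j'' mc ?c)) ?s t" and I: "?D (k * ?w) t"
    have fr': "frame {''z'', ''i'', ''j''} {M} s t" using fr by (auto simp: frame_def)
    show "runs N (For ''j'' mc ?c) t (\<lambda>s''. ?D (Suc k * ?w) (nupd ''i'' 0 (Suc k) s''))"
      by (rule runs_mono[OF inner[OF fr' k I]]) simp
  qed (use names xs(2) in auto)
  then have "runs N (Fill M r mr c mc) s (?D (length xs * ?w))"
    unfolding Fill_def by (intro runs_Seq_wp runs_NAssign) simp
  then show ?thesis
  proof (rule runs_mono; intro allI impI)
    fix s' i j
    assume D: "?D (length xs * ?w) s'" and ij: "i < length xs" "j < ?w"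
    have "i * ?w + j < Suc i * ?w" using ij by simp
    also have "\<dots> \<le> length xs * ?w" using ij by (intro mult_right_mono) auto
    finally have "rmem s' M (i * ?w + j) = X (ys ! ((i * ?w + j) mod ?w)) (xs ! ((i * ?w + j) div ?w))"
      using D by blast
    then show "rmem s' M (i * ?w + j) = X (ys ! j) (xs ! i)"
      using ij gr_implies_not0[OF ij(2)] by simp
  qed
qed

definition row_list :: "nat set \<Rightarrow> nat list" where
  "row_list B = filter (\<lambda>i. i \<in> B) [0..<m]"

text \<open>\<open>w\<close> is the width of this factor, \<open>d\<close> the step of the thinning,
  which is the width of the other factor.\<close>

definition factor_mat :: "nat set \<Rightarrow> nat \<Rightarrow> nat \<Rightarrow> real mat" where
  "factor_mat B w d = mat (length (row_list B)) w (\<lambda>(i, j). X (thinA B d ! j) (row_list B ! i))"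

definition valid :: "nat set \<Rightarrow> nat \<Rightarrow> nat \<Rightarrow> bool" where
  "valid A n1 n2 \<longleftrightarrow> n1 * n2 = n \<and> length (thinA A n2) = n1 \<and> length (thinA (- A) n1) = n2 \<and>
     row_list (- A) \<noteq> []"

definition good :: "nat set \<Rightarrow> state \<Rightarrow> bool" where
  "good A s \<longleftrightarrow> (\<exists>n1 n2. valid A n1 n2 \<and> output_S1 s = factor_mat A n1 n2 \<and>
     output_S2 s = factor_mat (- A) n2 n1)"

lemma row_list_bounds: "length (row_list B) \<le> N" "set (row_list B) \<subseteq> {..<m}"
  using length_filter_le[of "\<lambda>i. i \<in> B" "[0..<m]"] m_le by (auto simp: row_list_def)

lemma thin_bounds: "length (thin f d n) \<le> N" "set (thin f d n) \<subseteq> {..<n}"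
  using length_filter_le[of "\<lambda>j. rank f j mod d = 0" "[0..<n]"] n_le by (auto simp: thin_def)

definition ready :: "nat set \<Rightarrow> state \<Rightarrow> bool" where
  "ready A s \<longleftrightarrow> loaded s \<and> masked A s \<and> holds_list s ''ra'' ''m1'' (row_list A) \<and>
     holds_list s ''rb'' ''m2'' (row_list (- A))"

lemma ready_frame:
  assumes "frame Z Y s s'" "ready A s" "{''m'', ''n'', ''o'', ''a'', ''ra'', ''m1'', ''rb'', ''m2''} \<inter> Z = {}"
    "''S'' \<notin> Y"
  shows "ready A s'"
proof -
  have "''m'' \<notin> Z" "''n'' \<notin> Z" "''o'' \<notin> Z" "''a'' \<notin> Z" "''ra'' \<notin> Z" "''m1'' \<notin> Z" "''rb'' \<notin> Z" "''m2'' \<notin> Z"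
    using assms(3) by auto
  then show ?thesis
    using assms(2,4) loaded_frame[OF assms(1)] masked_frame[OF assms(1)] holds_list_frame[OF assms(1)]
    by (simp add: ready_def)
qed

lemma output_mat_eqI:
  assumes "holds_list s r mr xs" "nmem s w 0 = length ys"
    and "\<forall>i<length xs. \<forall>j<length ys. rmem s M (i * length ys + j) = X (ys ! j) (xs ! i)"
  shows "output_mat M mr w s = mat (length xs) (length ys) (\<lambda>(i, j). X (ys ! j) (xs ! i))"
  using assms by (intro eq_matI) (simp_all add: output_mat_def holds_list_def)

lemma runs_Output:
  assumes R: "ready A s" and v: "valid A n1 n2"
    and ca: "holds_list s ''ca'' ''ka'' (thinA A n2)" and cb: "holds_list s ''cb'' ''kb'' (thinA (- A) n1)"
  shows "runs N Output s (\<lambda>s'. output_yes s' \<and> good A s')"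
proof -
  let ?s = "nupd ''n2'' 0 n2 (nupd ''n1'' 0 n1 s)"
  have l: "length (thinA A n2) = n1" "length (thinA (- A) n1) = n2" using v by (simp_all add: valid_def)
  have k: "nmem s ''ka'' 0 = n1" "nmem s ''kb'' 0 = n2" using ca cb l by (simp_all add: holds_list_def)
  have fr0: "frame {''n1'', ''n2''} {} s ?s" by (simp add: frame_def)
  have R0: "ready A ?s" by (rule ready_frame[OF fr0 R]) simp_all
  have ca0: "holds_list ?s ''ca'' ''ka'' (thinA A n2)" by (rule holds_list_frame[OF fr0 ca]) simp_all
  have cb0: "holds_list ?s ''cb'' ''kb'' (thinA (- A) n1)" by (rule holds_list_frame[OF fr0 cb]) simp_all
  have fills: "runs N (Seq (Fill ''S1'' ''ra'' ''m1'' ''ca'' ''ka'')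
     (Seq (Fill ''S2'' ''rb'' ''m2'' ''cb'' ''kb'') (''yes'' ::= NConst 1))) ?s (\<lambda>s'. output_yes s' \<and> good A s')"
  proof (rule runs_Seq[OF runs_Fill[OF _ _ row_list_bounds[of A] ca0 thin_bounds]])
    show "loaded ?s" "holds_list ?s ''ra'' ''m1'' (row_list A)" using R0 by (simp_all add: ready_def)
    fix s1
    assume fr1: "frame (nw (Fill ''S1'' ''ra'' ''m1'' ''ca'' ''ka'')) (rw (Fill ''S1'' ''ra'' ''m1'' ''ca'' ''ka'')) ?s s1"
      and e1: "\<forall>i<length (row_list A). \<forall>j<length (thinA A n2).
        rmem s1 ''S1'' (i * length (thinA A n2) + j) = X (thinA A n2 ! j) (row_list A ! i)"
    note fr1 = fr1[simplified]
    have R1: "ready A s1" by (rule ready_frame[OF fr1 R0]) simp_all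
    have cb1: "holds_list s1 ''cb'' ''kb'' (thinA (- A) n1)" by (rule holds_list_frame[OF fr1 cb0]) simp_all
    show "runs N (Seq (Fill ''S2'' ''rb'' ''m2'' ''cb'' ''kb'') (''yes'' ::= NConst 1)) s1
      (\<lambda>s'. output_yes s' \<and> good A s')"
    proof (rule runs_Seq[OF runs_Fill[OF _ _ row_list_bounds[of "- A"] cb1 thin_bounds]])
      show "loaded s1" "holds_list s1 ''rb'' ''m2'' (row_list (- A))" using R1 by (simp_all add: ready_def)
      fix s2
      assume fr2: "frame (nw (Fill ''S2'' ''rb'' ''m2'' ''cb'' ''kb'')) (rw (Fill ''S2'' ''rb'' ''m2'' ''cb'' ''kb'')) s1 s2"
        and e2: "\<forall>i<length (row_list (- A)). \<forall>j<length (thinA (- A) n1).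
        rmem s2 ''S2'' (i * length (thinA (- A) n1) + j) = X (thinA (- A) n1 ! j) (row_list (- A) ! i)"
      note fr2 = fr2[simplified]
      let ?t = "nupd ''yes'' 0 1 s2"
      have fr3: "frame {''yes''} {} s2 ?t" by (simp add: frame_def)
      have "ready A s2" by (rule ready_frame[OF fr2 R1]) simp_all
      then have R3: "ready A ?t" by (rule ready_frame[OF fr3]) simp_all
      have w: "nmem ?t ''n1'' 0 = length (thinA A n2)" "nmem ?t ''n2'' 0 = length (thinA (- A) n1)"
        unfolding l by (simp_all add: frame_nmem[OF fr2] frame_nmem[OF fr1])
      have "output_S1 ?t = mat (length (row_list A)) (length (thinA A n2)) (\<lambda>(i, j). X (thinA A n2 ! j) (row_list A ! i))"
        unfolding output_S1_def
        by (rule output_mat_eqI[where r = "''ra''"]) (use R3 w e1 in \<open>simp_all add: ready_def frame_rmem[OF fr2]\<close>)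
      then have o1: "output_S1 ?t = factor_mat A n1 n2" by (simp only: factor_mat_def l)
      have "output_S2 ?t = mat (length (row_list (- A))) (length (thinA (- A) n1)) (\<lambda>(i, j). X (thinA (- A) n1 ! j) (row_list (- A) ! i))"
        unfolding output_S2_def
        by (rule output_mat_eqI[where r = "''rb''"]) (use R3 w e2 in \<open>simp_all add: ready_def\<close>)
      then have o2: "output_S2 ?t = factor_mat (- A) n2 n1" by (simp only: factor_mat_def l)
      have "output_yes ?t" by (simp add: output_yes_def)
      then show "runs N (''yes'' ::= NConst 1) s2 (\<lambda>s'. output_yes s' \<and> good A s')"
        using v o1 o2 by (intro runs_NAssign) (auto simp: good_def)
    qed simp_all
  qed simp_all
  show ?thesis unfolding Output_def
    by (rule runs_Seq_wp, rule runs_NAssign, rule runs_Seq_wp, rule runs_NAssign) (use fills in \<open>simp add: k\<close>)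
qed

section \<open>Trying all pairs of widths\<close>

text \<open>Soundness of the verdict, and its completeness for the pairs in \<open>W\<close>. The
  successful pair is not recorded, since a later one may overwrite the output with another valid
  factorisation.\<close>

definition tried :: "nat set \<Rightarrow> (nat \<times> nat) set \<Rightarrow> state \<Rightarrow> bool" where
  "tried A W s \<longleftrightarrow> (output_yes s \<longrightarrow> good A s) \<and> (\<forall>(a, b)\<in>W. valid A a b \<longrightarrow> output_yes s)"

lemma tried_frame:
  assumes "frame Z Y s s'" "{''yes'', ''m1'', ''n1'', ''m2'', ''n2''} \<inter> Z = {}" "{''S1'', ''S2''} \<inter> Y = {}"
  shows "tried A W s' = tried A W s"
proof -
  have "nmem s' v = nmem s v" if "v \<in> {''yes'', ''m1'', ''n1'', ''m2'', ''n2''}" for v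
    using assms(2) that by (intro frame_nmem[OF assms(1)]) blast
  moreover have "rmem s' v = rmem s v" if "v \<in> {''S1'', ''S2''}" for v
    using assms(3) that by (intro frame_rmem[OF assms(1)]) blast
  ultimately have "output_yes s' = output_yes s" "output_S1 s' = output_S1 s" "output_S2 s' = output_S2 s"
    by (simp_all add: output_yes_def output_S1_def output_S2_def output_mat_def)
  then show ?thesis by (simp add: tried_def good_def)
qed

lemma frame_nupd: "frame {v} {} s (nupd v i e s)"
  by (simp add: frame_def)

lemma tried_upd [simp]:
  "v \<notin> {''yes'', ''m1'', ''n1'', ''m2'', ''n2''} \<Longrightarrow> tried A W (nupd v i e s) = tried A W s"
  by (rule tried_frame[OF frame_nupd]) auto

lemma ready_upd:
  "ready A s \<Longrightarrow> v \<notin> {''m'', ''n'', ''o'', ''a'', ''ra'', ''m1'', ''rb'', ''m2''} \<Longrightarrow> ready A (nupd v i e s)"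
  by (rule ready_frame[OF frame_nupd]) auto

lemma runs_Attempt:
  assumes R: "ready A s" and h: "nmem s ''h1'' 0 = n1" "0 < n1" "nmem s ''h2'' 0 = n2" "0 < n2"
    and g: "nmem s ''g'' 0 = n1 * n2" and T: "tried A W s"
  shows "runs N Attempt s (tried A (insert (n1, n2) W))"
  unfolding Attempt_def
proof (rule runs_Seq[OF runs_Cols[where A = A and d = n2]])
  let ?b = "BAnd (NEq (V ''ka'') (V ''h1'')) (BAnd (NEq (V ''kb'') (V ''h2''))
         (BAnd (NEq (V ''g'') (V ''n'')) (NLess (NConst 0) (V ''m2''))))"
  show "loaded s" "masked A s" using R by (simp_all add: ready_def)
  fix s1
  assume fr1: "frame (nw (Cols 1 ''h2'' ''ca'' ''ka'')) (rw (Cols 1 ''h2'' ''ca'' ''ka'')) s s1"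
    and "holds_list s1 ''ca'' ''ka'' (thinA (side A 1) n2)"
  then have ca: "holds_list s1 ''ca'' ''ka'' (thinA A n2)" by simp
  note fr1 = fr1[simplified]
  have R1: "ready A s1" by (rule ready_frame[OF fr1 R]) simp_all
  have T1: "tried A W s1" using T by (subst tried_frame[OF fr1]) simp_all
  have h1: "nmem s1 ''h1'' 0 = n1" "nmem s1 ''h2'' 0 = n2" "nmem s1 ''g'' 0 = n1 * n2"
    using h g by (simp_all add: frame_nmem[OF fr1])
  show "runs N (Seq (Cols 0 ''h1'' ''cb'' ''kb'') (Cond ?b Output Skip)) s1 (tried A (insert (n1, n2) W))"
  proof (rule runs_Seq[OF runs_Cols[where A = A and d = n1]])
    show "loaded s1" "masked A s1" using R1 by (simp_all add: ready_def)
    fix s2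
    assume fr2: "frame (nw (Cols 0 ''h1'' ''cb'' ''kb'')) (rw (Cols 0 ''h1'' ''cb'' ''kb'')) s1 s2"
      and "holds_list s2 ''cb'' ''kb'' (thinA (side A 0) n1)"
    then have cb: "holds_list s2 ''cb'' ''kb'' (thinA (- A) n1)" by simp
    note fr2 = fr2[simplified]
    have ca2: "holds_list s2 ''ca'' ''ka'' (thinA A n2)" by (rule holds_list_frame[OF fr2 ca]) simp_all
    have R2: "ready A s2" by (rule ready_frame[OF fr2 R1]) simp_all
    have T2: "tried A W s2" using T1 by (subst tried_frame[OF fr2]) simp_all
    have h2: "nmem s2 ''h1'' 0 = n1" "nmem s2 ''h2'' 0 = n2" "nmem s2 ''g'' 0 = n1 * n2"
      using h1 by (simp_all add: frame_nmem[OF fr2])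
    have b: "bval ?b s2 \<longleftrightarrow> valid A n1 n2"
      using ca2 cb R2 h2 by (auto simp: valid_def holds_list_def ready_def loaded_def)
    show "runs N (Cond ?b Output Skip) s2 (tried A (insert (n1, n2) W))"
    proof (rule runs_Cond)
      assume "bval ?b s2"
      then have v: "valid A n1 n2" using b by simp
      show "runs N Output s2 (tried A (insert (n1, n2) W))"
        by (rule runs_mono[OF runs_Output[OF R2 v ca2 cb]]) (auto simp: tried_def)
    next
      assume "\<not> bval ?b s2"
      then show "runs N Skip s2 (tried A (insert (n1, n2) W))"
        using b T2 by (intro runs_Skip) (auto simp: tried_def)
    qed
  qed (use h h1 in simp_all)
qed (use h in simp_all)

lemma runs_Factor:
  assumes R: "ready A s" and no: "\<not> output_yes s"
  shows "runs N Factor s (\<lambda>s'. (output_yes s' \<longrightarrow> good A s') \<and> ((\<exists>n1 n2. valid A n1 n2) \<longrightarrow> output_yes s'))"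
proof -
  let ?c = "Seq (''h2'' ::= NAdd (V ''y'') (NConst 1)) (Seq (''g'' ::= NAdd (V ''g'') (V ''h1'')) Attempt)"
  let ?d = "Seq (''h1'' ::= NAdd (V ''x'') (NConst 1)) (Seq (''g'' ::= NConst 0) (For ''y'' ''n'' ?c))"
  let ?W = "\<lambda>k. {1..k} \<times> {1..n}"
  have inner: "runs N (For ''y'' ''n'' ?c) s' (tried A (?W (Suc k)))"
    if R': "ready A s'" and k: "nmem s' ''h1'' 0 = Suc k" "nmem s' ''g'' 0 = 0" and T: "tried A (?W k) s'" for k s'
  \<comment> \<open>Adding \<open>h1\<close> once per iteration keeps \<open>g\<close> equal to the
    product of the widths.\<close>
  proof (rule runs_For[where K = n and
        I = "\<lambda>l t. nmem t ''g'' 0 = Suc k * l \<and> tried A (?W k \<union> {Suc k} \<times> {1..l}) t"])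
    show "nmem s' ''n'' 0 = n" using R' by (simp add: ready_def loaded_def)
    show "nmem (nupd ''y'' 0 0 s') ''g'' 0 = Suc k * 0 \<and>
        tried A (?W k \<union> {Suc k} \<times> {1..0}) (nupd ''y'' 0 0 s')"
      using k T by simp
    fix l t
    assume l: "l < n" "nmem t ''y'' 0 = l" and fr: "frame (insert ''y'' (nw ?c)) (rw ?c) s' t"
      and I: "nmem t ''g'' 0 = Suc k * l \<and> tried A (?W k \<union> {Suc k} \<times> {1..l}) t"
    note fr = fr[simplified]
    have Rt: "ready A t" by (rule ready_frame[OF fr R']) simp_all
    have ht: "nmem t ''h1'' 0 = Suc k" using k by (simp add: frame_nmem[OF fr])
    let ?t = "nupd ''g'' 0 (Suc k * Suc l) (nupd ''h2'' 0 (Suc l) t)"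
    have T': "tried A (?W k \<union> {Suc k} \<times> {1..l}) ?t" using I by simp
    have e: "insert (Suc k, Suc l) (?W k \<union> {Suc k} \<times> {1..l}) = ?W k \<union> {Suc k} \<times> {1..Suc l}"
      by (auto simp: le_Suc_eq)
    have Rt': "ready A ?t" by (intro ready_upd Rt) simp_all
    have "runs N Attempt ?t (tried A (insert (Suc k, Suc l) (?W k \<union> {Suc k} \<times> {1..l})))"
      by (rule runs_Attempt[OF Rt' _ _ _ _ _ T']) (use ht in simp_all)
    then have "runs N Attempt ?t (\<lambda>s''. nmem (nupd ''y'' 0 (Suc l) s'') ''g'' 0 = Suc k * Suc l \<and>
        tried A (?W k \<union> {Suc k} \<times> {1..Suc l}) (nupd ''y'' 0 (Suc l) s''))"
      unfolding e by (rule runs_mono) (simp add: frame_nmem)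
    then show "runs N ?c t (\<lambda>s''. nmem (nupd ''y'' 0 (Suc l) s'') ''g'' 0 = Suc k * Suc l \<and>
        tried A (?W k \<union> {Suc k} \<times> {1..Suc l}) (nupd ''y'' 0 (Suc l) s''))"
      using I by (intro runs_Seq_wp runs_NAssign) (simp add: l ht add.commute)
  next
    fix t :: state
    assume "nmem t ''g'' 0 = Suc k * n \<and> tried A (?W k \<union> {Suc k} \<times> {1..n}) t"
    moreover have "?W k \<union> {Suc k} \<times> {1..n} = ?W (Suc k)" by auto
    ultimately show "tried A (?W (Suc k)) t" by simp
  qed (use n_le in simp_all)
  show ?thesis
    unfolding Factor_def
  proof (rule runs_For[where K = n and I = "\<lambda>k t. tried A (?W k) t"])
    show "nmem s ''n'' 0 = n" using R by (simp add: ready_def loaded_def)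
    show "tried A (?W 0) (nupd ''x'' 0 0 s)" using no by (simp add: tried_def output_yes_def)
    fix k t
    assume k: "k < n" "nmem t ''x'' 0 = k" and fr: "frame (insert ''x'' (nw ?d)) (rw ?d) s t" and I: "tried A (?W k) t"
    note fr = fr[simplified]
    let ?t = "nupd ''g'' 0 0 (nupd ''h1'' 0 (Suc k) t)"
    have "ready A t" by (rule ready_frame[OF fr R]) simp_all
    then have "ready A ?t" by (intro ready_upd) simp_all
    then have "runs N (For ''y'' ''n'' ?c) ?t (tried A (?W (Suc k)))" by (rule inner) (use I in simp_all)
    then have "runs N (For ''y'' ''n'' ?c) ?t (\<lambda>s''. tried A (?W (Suc k)) (nupd ''x'' 0 (Suc k) s''))"
      by (rule runs_mono) simp
    then show "runs N ?d t (\<lambda>s''. tried A (?W (Suc k)) (nupd ''x'' 0 (Suc k) s''))"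
      by (intro runs_Seq_wp runs_NAssign) (simp add: k)
  next
    fix t :: state assume T: "tried A (?W n) t"
    \<comment> \<open>Valid widths are positive divisors of \<open>n\<close>, so the search square
      contains them.\<close>
    have W: "(n1, n2) \<in> ?W n" if "valid A n1 n2" for n1 n2
    proof -
      have N: "n1 * n2 = n" using that by (simp add: valid_def)
      then have "0 < n1 * n2" using n_pos by simp
      moreover have "n1 dvd n" "n2 dvd n" using N by auto
      ultimately show ?thesis using n_pos by (auto dest: dvd_imp_le)
    qed
    have "output_yes t" if "valid A n1 n2" for n1 n2
      using bspec[OF conjunct2[OF T[unfolded tried_def]] W[OF that]] that by simp
    then show "(output_yes t \<longrightarrow> good A t) \<and> ((\<exists>n1 n2. valid A n1 n2) \<longrightarrow> output_yes t)"
      using conjunct1[OF T[unfolded tried_def]] by blast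
  qed (use n_le in simp_all)
qed

lemma runs_Offsets:
  assumes "nmem s ''m'' 0 = m" "nmem s ''n'' 0 = n" "\<forall>i<m. \<forall>j<n. rmem s ''S'' (i * n + j) = X j i"
  shows "runs N Offsets s loaded"
proof -
  let ?c = "Seq (NAssign ''o'' (V ''i'') (V ''z'')) (''z'' ::= NAdd (V ''z'') (V ''n''))"
  let ?I = "\<lambda>k t. nmem t ''z'' 0 = k * n \<and> (\<forall>i<k. nmem t ''o'' i = i * n)"
  have "runs N (For ''i'' ''m'' ?c) (nupd ''z'' 0 0 s) loaded"
  proof (rule runs_For[where K = m and I = ?I])
    fix k t
    assume k: "k < m" "nmem t ''i'' 0 = k" and fr: "frame (insert ''i'' (nw ?c)) (rw ?c) (nupd ''z'' 0 0 s) t"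
      and I: "?I k t"
    have "nmem t ''n'' 0 = n" using assms(2) by (simp add: frame_nmem[OF fr])
    then show "runs N ?c t (\<lambda>s''. ?I (Suc k) (nupd ''i'' 0 (Suc k) s''))"
      using k I by (intro runs_Seq_wp runs_NAssign) (simp add: less_Suc_eq)
  next
    fix t
    assume fr: "frame (insert ''i'' (nw ?c)) (rw ?c) (nupd ''z'' 0 0 s) t" and "?I m t"
    then show "loaded t" using assms by (simp add: loaded_def frame_nmem[OF fr] frame_rmem[OF fr])
  qed (use assms m_le in simp_all)
  then show ?thesis unfolding Offsets_def by (intro runs_Seq_wp runs_NAssign) simp
qed

text \<open>Initial zeros matter twice: \<open>a\<close> must represent the empty set before row 0
  enters, and \<open>yes\<close> must not report success before a pair has been tried.\<close>

lemma runs_Algorithm: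
  assumes "nmem s ''m'' 0 = m" "nmem s ''n'' 0 = n" "\<forall>i<m. \<forall>j<n. rmem s ''S'' (i * n + j) = X j i"
    and a: "\<And>i. nmem s ''a'' i = 0" and no: "\<not> output_yes s"
  shows "runs N Algorithm s (\<lambda>s'. \<exists>A. stable A \<and> (output_yes s' \<longrightarrow> good A s') \<and>
    ((\<exists>n1 n2. valid A n1 n2) \<longrightarrow> output_yes s'))"
    (is "runs N _ s ?Q")
  unfolding Algorithm_def
proof (rule runs_Cond)
  show "runs N (Seq Offsets (Seq Closure (Seq (Rows 1 ''ra'' ''m1'') (Seq (Rows 0 ''rb'' ''m2'') Factor)))) s ?Q"
  proof (rule runs_Seq[OF runs_Offsets[OF assms(1-3)]])
    fix s1 assume fr1: "frame (nw Offsets) (rw Offsets) s s1" and L1: "loaded s1"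
    note fr1 = fr1[unfolded Offsets_def, simplified]
    have a1: "nmem s1 ''a'' i = 0" for i using a by (simp add: frame_nmem[OF fr1])
    have no1: "\<not> output_yes s1" using no by (simp add: output_yes_def frame_nmem[OF fr1])
    show "runs N (Seq Closure (Seq (Rows 1 ''ra'' ''m1'') (Seq (Rows 0 ''rb'' ''m2'') Factor))) s1 ?Q"
    proof (rule runs_Seq[OF runs_Closure[OF L1 a1]])
      fix s2 assume fr2: "frame (nw Closure) (rw Closure) s1 s2" and "\<exists>A. stable A \<and> masked A s2"
      then obtain A where A: "stable A" "masked A s2" by blast
      note fr2 = fr2[unfolded Closure_def, simplified]
      have L2: "loaded s2" by (rule loaded_frame[OF fr2 L1]) simp_all
      have no2: "\<not> output_yes s2" using no1 by (simp add: output_yes_def frame_nmem[OF fr2])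
      show "runs N (Seq (Rows 1 ''ra'' ''m1'') (Seq (Rows 0 ''rb'' ''m2'') Factor)) s2 ?Q"
      proof (rule runs_Seq[OF runs_Rows[OF L2 A(2)]])
        fix s3
        assume fr3: "frame (nw (Rows 1 ''ra'' ''m1'')) (rw (Rows 1 ''ra'' ''m1'')) s2 s3"
          and "holds_list s3 ''ra'' ''m1'' (filter (\<lambda>i. i \<in> side A 1) [0..<m])"
        then have ra: "holds_list s3 ''ra'' ''m1'' (row_list A)" by (simp add: row_list_def)
        note fr3 = fr3[simplified]
        have L3: "loaded s3" by (rule loaded_frame[OF fr3 L2]) simp_all
        have A3: "masked A s3" by (rule masked_frame[OF fr3 A(2)]) simp
        have no3: "\<not> output_yes s3" using no2 by (simp add: output_yes_def frame_nmem[OF fr3])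
        show "runs N (Seq (Rows 0 ''rb'' ''m2'') Factor) s3 ?Q"
        proof (rule runs_Seq[OF runs_Rows[OF L3 A3]])
          fix s4
          assume fr4: "frame (nw (Rows 0 ''rb'' ''m2'')) (rw (Rows 0 ''rb'' ''m2'')) s3 s4"
            and rb: "holds_list s4 ''rb'' ''m2'' (filter (\<lambda>i. i \<in> side A 0) [0..<m])"
          note fr4 = fr4[simplified]
          have "loaded s4" by (rule loaded_frame[OF fr4 L3]) simp_all
          moreover have "masked A s4" by (rule masked_frame[OF fr4 A3]) simp
          moreover have "holds_list s4 ''ra'' ''m1'' (row_list A)" by (rule holds_list_frame[OF fr4 ra]) simp_all
          ultimately have R: "ready A s4" using rb by (simp add: ready_def row_list_def)
          have no4: "\<not> output_yes s4" using no3 by (simp add: output_yes_def frame_nmem[OF fr4])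
          show "runs N Factor s4 ?Q"
            by (rule runs_mono[OF runs_Factor[OF R no4]]) (use A(1) in blast)
        qed simp_all
      qed simp_all
    qed
  qed
next
  assume "\<not> bval (BAnd (NLess (NConst 0) (V ''m'')) (NLess (NConst 0) (V ''n''))) s"
  then show "runs N Skip s ?Q" using assms m_pos n_pos by simp
qed

section \<open>Soundness, completeness and the final bound\<close>

lemma good_matrix_iso:
  assumes S: "S \<in> carrier_mat m n" "X = mcols S" and A: "stable A" and g: "good A s"
  shows "nonempty_mat (output_S1 s)" "nonempty_mat (output_S2 s)"
    "matrix_iso S (output_S1 s \<otimes>\<^sub>1 output_S2 s)"
proof -
  obtain n1 n2 where v: "n1 * n2 = n" "length (thinA A n2) = n1" "length (thinA (- A) n1) = n2" "row_list (- A) \<noteq> []"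
    and o: "output_S1 s = factor_mat A n1 n2" "output_S2 s = factor_mat (- A) n2 n1"
    using g by (auto simp: good_def valid_def)
  have "0 \<in> set (row_list A)" using A m_pos by (simp add: row_list_def stable_def)
  then have "row_list A \<noteq> []" by auto
  moreover have "0 < n1 * n2" using v(1) n_pos by simp
  ultimately show "nonempty_mat (output_S1 s)" "nonempty_mat (output_S2 s)"
    using v(4) by (auto simp: o nonempty_mat_def factor_mat_def)
  show "matrix_iso S (output_S1 s \<otimes>\<^sub>1 output_S2 s)"
    using matrix_iso_thin[OF S _ n_pos v(1-3)] A by (simp add: o factor_mat_def row_list_def stable_def)
qed

text \<open>The block \<open>A'\<close> of the given factorisation is proper and contains
  \<open>A\<close>, so rows remain outside \<open>A\<close>. The widths come from \<open>A\<close>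
  itself and may differ from those of the given factors.\<close>

lemma one_product_valid:
  assumes S: "S \<in> carrier_mat m n" "X = mcols S" and A: "stable A" and one: "is_one_product S"
  shows "\<exists>n1 n2. valid A n1 n2"
proof -
  have d: "dim_row S = m" "dim_col S = n" using S(1) by auto
  obtain A' where A': "0 \<in> A'" "A' \<subset> {..<dim_row S}" "0 < dim_col S"
    "columns.factors (dim_row S) (dim_col S) (mcols S) A'"
    by (rule one_product_factors[OF one])
  have "factors A'" using A'(4) by (simp only: d S(2))
  then have "A \<subseteq> A'" using A A'(1) unfolding stable_def by blast
  then obtain i where "i < m" "i \<notin> A" using A'(2) unfolding d by blast
  then have "i \<in> set (row_list (- A))" by (simp add: row_list_def)
  then have "row_list (- A) \<noteq> []" by auto
  moreover have "\<exists>n1 n2. n1 * n2 = n \<and> length (thinA A n2) = n1 \<and> length (thinA (- A) n1) = n2"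
    by (rule ex_thin[OF _ n_pos]) (use A in \<open>simp add: stable_def\<close>)
  ultimately show ?thesis unfolding valid_def by blast
qed

end

lemma Algorithm_correct:
  assumes S: "S \<in> carrier_mat m n"
  shows "runs (m + n) Algorithm (input_state S) (\<lambda>s'. (output_yes s' \<longleftrightarrow> is_one_product S) \<and>
    (is_one_product S \<longrightarrow> nonempty_mat (output_S1 s') \<and> nonempty_mat (output_S2 s') \<and>
       matrix_iso S (output_S1 s' \<otimes>\<^sub>1 output_S2 s')))"
    (is "runs _ _ _ ?Q")
proof (cases "0 < m \<and> 0 < n")
  case False
  have "\<not> is_one_product S"
  proof
    assume "is_one_product S"
    then obtain A where "0 \<in> A" "A \<subset> {..<dim_row S}" "0 < dim_col S" by (rule one_product_factors)
    then show False using False S by auto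
  qed
  moreover have "\<not> output_yes (input_state S)" by (simp add: output_yes_def input_state_def)
  ultimately show ?thesis using False S unfolding Algorithm_def
    by (intro runs_Cond runs_Skip) (auto simp: input_state_def)
next
  case True
  \<comment> \<open>The sum of the dimensions dominates both, so it serves as the bound for all
    loops.\<close>
  interpret real_columns m n "mcols S" "m + n" by unfold_locales (use True in auto)
  have "rmem (input_state S) ''S'' (i * n + j) = mcols S j i" if "i < m" "j < n" for i j
  proof -
    have "i * n + j < Suc i * n" using that by simp
    also have "\<dots> \<le> m * n" using that by (intro mult_right_mono) auto
    finally show ?thesis using that S True by (simp add: input_state_def mcols_def)
  qed
  then have "runs (m + n) Algorithm (input_state S) (\<lambda>s'. \<exists>A. stable A \<and> (output_yes s' \<longrightarrow> good A s') \<and>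
    ((\<exists>n1 n2. valid A n1 n2) \<longrightarrow> output_yes s'))"
    using S by (intro runs_Algorithm) (auto simp: input_state_def output_yes_def)
  then show ?thesis
  proof (rule runs_mono)
    fix s'
    assume "\<exists>A. stable A \<and> (output_yes s' \<longrightarrow> good A s') \<and> ((\<exists>n1 n2. valid A n1 n2) \<longrightarrow> output_yes s')"
    then obtain A where A: "stable A" "output_yes s' \<Longrightarrow> good A s'" "\<exists>n1 n2. valid A n1 n2 \<Longrightarrow> output_yes s'"
      by blast
    have yes: "output_yes s'" if "is_one_product S"
      using A(3) one_product_valid[OF S refl A(1) that] by blast
    note iso = good_matrix_iso[OF S refl A(1) A(2)]
    have "is_one_product S" if "output_yes s'"
      unfolding is_one_product_def using iso[OF that] by blast
    then show "?Q s'" using yes iso by blast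
  qed
qed

theorem theorem3p3:
  "\<exists>(alg :: com) (c :: nat) (k :: nat).
     \<forall>(m :: nat) (n :: nat) (S :: real mat). S \<in> carrier_mat m n \<longrightarrow>
       (\<exists>t s'. exec alg (input_state S) t s' \<and>
          t \<le> c * (m + n + 1) ^ k \<and>
          (output_yes s' \<longleftrightarrow> is_one_product S) \<and>
          (is_one_product S \<longrightarrow>
             nonempty_mat (output_S1 s') \<and> nonempty_mat (output_S2 s') \<and>
             matrix_iso S (output_S1 s' \<otimes>\<^sub>1 output_S2 s')))"
proof -
  \<comment> \<open>The constants depend only on the fixed program text, hence are uniform in
    \<open>m\<close>, \<open>n\<close> and \<open>S\<close>.\<close>
  obtain c k where ck: "\<And>N. tb N Algorithm \<le> c * (N + 1) ^ k" using tb_polynomial by blast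
  show ?thesis
    using Algorithm_correct unfolding runs_def
    by (intro exI[of _ Algorithm] exI[of _ c] exI[of _ k]) (meson ck order_trans)
qed

end
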